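(* The map $\mathbb Q\mathcal B\otimes\mathcal YSym\to\mathcal MSym_+$ defined by $b\otimes M_s\mapsto M_{b\backslash s}$ (for $b\in\mathcal B$, $s\in\mathcal Y_\bullet$) is an isomorphism of graded right $\mathcal YSym$-comodules. Moreover, the quotient of enumerating series $\mathbf M_+(q)/\mathbf Y(q)$ is equal to the enumerating series $\sum_{n}|\mathcal B\cap\mathcal M_n|\,q^n$ of the graded set $\mathcal B$.
   Context: Trees. $\mathcal Y_n$ is the set of rooted planar binary trees with $n$ internal nodes, $\mathcal Y_\bullet=\bigsqcup_{n\ge0}\mathcal Y_n$; $|$ is the tree with no nodes; $t_\ell\vee t_r$ is the tree whose root node has left and right subtrees $t_\ell,t_r$. A tree in $\mathcal Y_n$ has leaves numbered $0,\dots,n$ and nodes numbered $1,\dots,n$ from left to right (node $i$ is the gap between leaves $i-1$ and $i$). Its node poset has the internal edges as Hasse diagram and the root as maximum. The Tamari order on $\mathcal Y_n$ has covers given by replacing a subtree $(x\vee y)\vee z$ by $x\vee(y\vee z)$. Splitting $t\in\mathcal Y_n$ along leaf $i$ means cutting along the path from leaf $i$ to the root, giving $t\to(t_0,t_1)$ with $t_0\in\mathcal Y_i$ containing nodes $1,\dots,i$ and $t_1\in\mathcal Y_{n-i}$ containing nodes $i+1,\dots,n$. Recursively: $|\to(|,|)$; for $t=a\vee c$, $a\in\mathcal Y_p$, if $i\le p$ and $a\to(a_0,a_1)$ along leaf $i$ then $t\to(a_0,a_1\vee c)$; if $i>p$ and $c\to(c_0,c_1)$ along leaf $i-p-1$ then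 $t\to(a\vee c_0,c_1)$. Bi-leveled trees. For $n\ge1$, $\mathcal M_n$ is the set of pairs $b=(t;\mathsf T)$ with $t\in\mathcal Y_n$ and $\mathsf T\subseteq\{1,\dots,n\}$ an upper order ideal of the node poset of $t$ containing the leftmost node (node $1$) as a minimal element of $\mathsf T$; $\mathcal M_+=\bigsqcup_{n\ge1}\mathcal M_n$. The order on $\mathcal M_n$: $(s;\mathsf S)\le(t;\mathsf T)$ iff $s\le t$ in the Tamari order and $\mathsf S\supseteq\mathsf T$. For $c\in\mathcal M_+$ and $s\in\mathcal Y_\bullet$, $c\backslash s$ is the bi-leveled tree whose underlying tree is obtained by grafting the root of $s$ onto the rightmost leaf of the underlying tree of $c$, with order ideal that of $c$. $\mathcal B\subset\mathcal M_+$ is the set of indecomposable bi-leveled trees: those $b$ whose only decomposition $b=c\backslash s$ is the trivial one $b=b\backslash|$. $\mathbb Q\mathcal B$ is the $\mathbb Q$-vector space with basis $\mathcal B$, graded by number of nodes. Spaces. $\mathcal YSym$ (Loday–Ronco Hopf algebra) is the graded $\mathbb Q$-vector space with basis $\{F_t\mid t\in\mathcal Y_\bullet\}$ and coproduct $\Delta F_t=\sum_{t\to(t_0,t_1)}F_{t_0}\otimes F_{t_1}$ (sum over splittings along one leaf); $\mathcal MSym_+$ is the graded $\mathbb Q$-vector space with basis $\{F_b\mid b\in\mathcal M_+\}$. With $\mu$ the Möbius function of $\mathcal Y_n$ (Tamari) resp. $\mathcal M_n$, $M_t=\sum_{t\le s}\mu(t,s)F_s$ and $M_b=\sum_{b\le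 c}\mu(b,c)F_c$. The right $\mathcal YSym$-comodule structure on $\mathcal MSym_+$ is $\boldsymbol\rho_+(F_b)=\sum F_{b_0}\otimes F_{\phi(b_1)}$, where for $b=(t;\mathsf T)$ the sum is over splittings $t\to(t_0,t_1)$ along one leaf with $t_0\ne|$, $b_0=(t_0;\mathsf T|_{t_0})\in\mathcal M_+$ ($\mathsf T|_{t_0}$ being the nodes of $t_0$ coming from $\mathsf T$) and $\phi(b_1)=t_1$. The comodule structure on $\mathbb Q\mathcal B\otimes\mathcal YSym$ is $b\otimes M_s\mapsto b\otimes\Delta(M_s)$. Series. $\mathbf M_+(q)=\sum_{n\ge1}|\mathcal M_n|q^n$ and $\mathbf Y(q)=\sum_{n\ge0}|\mathcal Y_n|q^n$. *)

theory Defs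
  imports
    Complex_Main
    "HOL-Library.Poly_Mapping"
    "HOL-Computational_Algebra.Formal_Power_Series"
begin

section \<open>Moebius functions\<close>

class locally_finite_order = order +
  assumes finite_Icc: "finite {x..y}"

function mobius :: "'a::locally_finite_order \<Rightarrow> 'a \<Rightarrow> rat" where
  "mobius x y =
     (if x = y then 1 else if x < y then - (\<Sum>z\<in>{x..<y}. mobius x z) else 0)"
  by auto
termination
proof (relation "measure (\<lambda>(x, y). card {x..y})", goal_cases)
  case 1
  show ?case by simp
next
  case (2 x y z)
  then have "{x..z} \<subset> {x..y}"
    by (auto intro: order.trans less_imp_le)
  then show ?case
    by (simp add: psubset_card_mono finite_Icc)
qed

declare mobius.simps [simp del]


section \<open>Planar binary trees\<close>

datatype ptree = Leaf | Node ptree ptree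

primrec nnodes :: "ptree \<Rightarrow> nat" where
  "nnodes Leaf = 0"
| "nnodes (Node l r) = Suc (nnodes l + nnodes r)"

lemma nnodes_0_iff [simp]: "nnodes t = 0 \<longleftrightarrow> t = Leaf"
  by (cases t) auto

lemma finite_trees: "finite {t. nnodes t = n}"
proof (induction n rule: less_induct)
  case (less n)
  have "{t. nnodes t = n} \<subseteq>
      insert Leaf (case_prod Node ` ((\<Union>k<n. {t. nnodes t = k}) \<times> (\<Union>k<n. {t. nnodes t = k})))"
  proof
    fix t assume "t \<in> {t. nnodes t = n}"
    then show "t \<in> insert Leaf
        (case_prod Node ` ((\<Union>k<n. {t. nnodes t = k}) \<times> (\<Union>k<n. {t. nnodes t = k})))"
      by (cases t) (auto intro!: image_eqI[where x = "(_, _)"])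
  qed
  then show ?case
    by (rule finite_subset) (use less in auto)
qed

subsection \<open>The Tamari order\<close>

inductive tamari_cover :: "ptree \<Rightarrow> ptree \<Rightarrow> bool" where
  rotate: "tamari_cover (Node (Node x y) z) (Node x (Node y z))"
| left: "tamari_cover l l' \<Longrightarrow> tamari_cover (Node l r) (Node l' r)"
| right: "tamari_cover r r' \<Longrightarrow> tamari_cover (Node l r) (Node l r')"

lemma tamari_cover_nnodes: "tamari_cover s t \<Longrightarrow> nnodes s = nnodes t"
  by (induction rule: tamari_cover.induct) auto

lemma tamari_nnodes: "tamari_cover\<^sup>*\<^sup>* s t \<Longrightarrow> nnodes s = nnodes t"
  by (induction rule: rtranclp_induct) (auto dest: tamari_cover_nnodes)

primrec right_weight :: "ptree \<Rightarrow> nat" where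
  "right_weight Leaf = 0"
| "right_weight (Node l r) = nnodes r + right_weight l + right_weight r"

lemma tamari_cover_right_weight: "tamari_cover s t \<Longrightarrow> right_weight s < right_weight t"
  by (induction rule: tamari_cover.induct) (auto dest: tamari_cover_nnodes)

lemma tamari_right_weight: "tamari_cover\<^sup>*\<^sup>* s t \<Longrightarrow> s = t \<or> right_weight s < right_weight t"
  by (induction rule: rtranclp_induct) (auto dest: tamari_cover_right_weight)

instantiation ptree :: order
begin

definition less_eq_ptree :: "ptree \<Rightarrow> ptree \<Rightarrow> bool" where
  "s \<le> t \<longleftrightarrow> tamari_cover\<^sup>*\<^sup>* s t"

definition less_ptree :: "ptree \<Rightarrow> ptree \<Rightarrow> bool" where
  "s < t \<longleftrightarrow> s \<le> t \<and> \<not> t \<le> (s :: ptree)"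

instance
  by intro_classes
     (auto simp: less_eq_ptree_def less_ptree_def dest!: tamari_right_weight)

end

lemma le_nnodes: "s \<le> t \<Longrightarrow> nnodes s = nnodes t"
  by (simp add: less_eq_ptree_def tamari_nnodes)

instance ptree :: locally_finite_order
proof
  fix x y :: ptree
  show "finite {x..y}"
    by (rule finite_subset[OF _ finite_trees[of "nnodes x"]]) (auto intro: le_nnodes[symmetric])
qed

subsection \<open>The node poset\<close>

text \<open>
  Nodes are the numbers from 1 to \<open>nnodes t\<close>, in left-to-right order. A pair
  \<open>(i, j)\<close> in \<open>edges t\<close> is an internal edge from the node \<open>i\<close> up to its parent \<open>j\<close>.
\<close>

fun root_node :: "ptree \<Rightarrow> nat" where
  "root_node Leaf = 0"
| "root_node (Node l r) = Suc (nnodes l)"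

fun edges :: "ptree \<Rightarrow> (nat \<times> nat) set" where
  "edges Leaf = {}"
| "edges (Node l r) =
     (let p = Suc (nnodes l) in
        edges l \<union> {(p + i, p + j) | i j. (i, j) \<in> edges r}
        \<union> (if l = Leaf then {} else {(root_node l, p)})
        \<union> (if r = Leaf then {} else {(p + root_node r, p)}))"

definition node_le :: "ptree \<Rightarrow> nat \<Rightarrow> nat \<Rightarrow> bool" where
  "node_le t i j \<longleftrightarrow> (i, j) \<in> (edges t)\<^sup>*"

lemma root_node_bounds: "t \<noteq> Leaf \<Longrightarrow> root_node t \<in> {1..nnodes t}"
  by (cases t) auto

lemma edges_Node_iff:
  "(i, j) \<in> edges (Node l r) \<longleftrightarrow>
     (i, j) \<in> edges l
     \<or> (\<exists>i' j'. i = Suc (nnodes l) + i' \<and> j = Suc (nnodes l) + j' \<and> (i', j') \<in> edges r)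
     \<or> (l \<noteq> Leaf \<and> i = root_node l \<and> j = Suc (nnodes l))
     \<or> (r \<noteq> Leaf \<and> i = Suc (nnodes l) + root_node r \<and> j = Suc (nnodes l))"
  by (auto simp: Let_def)

declare edges.simps(2) [simp del]

lemma edges_Node_single: "edges (Node Leaf Leaf) = {}"
  by (simp add: edges.simps(2) Let_def)

lemma edges_bounds: "(i, j) \<in> edges t \<Longrightarrow> i \<in> {1..nnodes t} \<and> j \<in> {1..nnodes t}"
proof (induction t arbitrary: i j)
  case (Node l r)
  from Node.prems consider
      "(i, j) \<in> edges l"
    | i' j' where "i = Suc (nnodes l) + i'" "j = Suc (nnodes l) + j'" "(i', j') \<in> edges r"
    | "l \<noteq> Leaf" "i = root_node l" "j = Suc (nnodes l)"
    | "r \<noteq> Leaf" "i = Suc (nnodes l) + root_node r" "j = Suc (nnodes l)"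
    unfolding edges_Node_iff by blast
  then show ?case
  proof cases
    case 1
    then show ?thesis using Node.IH(1)[of i j] by simp
  next
    case 2
    then show ?thesis using Node.IH(2)[of i' j'] by simp
  next
    case 3
    then show ?thesis using root_node_bounds[of l] by simp
  next
    case 4
    then show ?thesis using root_node_bounds[of r] by simp
  qed
qed simp

lemma edges_shift:
  assumes "(i, j) \<in> (edges r)\<^sup>*"
  shows "(Suc (nnodes l) + i, Suc (nnodes l) + j) \<in> (edges (Node l r))\<^sup>*"
  using assms
proof (induction rule: rtrancl_induct)
  case (step y z)
  then have "(Suc (nnodes l) + y, Suc (nnodes l) + z) \<in> edges (Node l r)"
    by (auto simp: edges_Node_iff)
  with step show ?case by (meson rtrancl.rtrancl_into_rtrancl)
qed simp

lemma edges_left: "(edges l)\<^sup>* \<subseteq> (edges (Node l r))\<^sup>*"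
  by (rule rtrancl_mono) (auto simp: edges_Node_iff)

lemma node_le_root: "i \<in> {1..nnodes t} \<Longrightarrow> (i, root_node t) \<in> (edges t)\<^sup>*"
proof (induction t arbitrary: i)
  case (Node l r)
  consider "i \<le> nnodes l" | "i = Suc (nnodes l)" | "i > Suc (nnodes l)" by linarith
  then show ?case
  proof cases
    case 1
    then have "(i, root_node l) \<in> (edges (Node l r))\<^sup>*" and "l \<noteq> Leaf"
      using Node edges_left[of l r] by auto
    moreover from \<open>l \<noteq> Leaf\<close> have "(root_node l, Suc (nnodes l)) \<in> edges (Node l r)"
      by (simp add: edges_Node_iff)
    ultimately show ?thesis by (simp add: rtrancl.rtrancl_into_rtrancl)
  next
    case 3
    define j where "j = i - Suc (nnodes l)"
    have j: "j \<in> {1..nnodes r}" "i = Suc (nnodes l) + j" using 3 Node.prems by (auto simp: j_def)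
    have "(i, Suc (nnodes l) + root_node r) \<in> (edges (Node l r))\<^sup>*"
      unfolding j(2) by (rule edges_shift) (use Node.IH(2) j in auto)
    moreover have "r \<noteq> Leaf" using j by auto
    then have "(Suc (nnodes l) + root_node r, Suc (nnodes l)) \<in> edges (Node l r)"
      by (simp add: edges_Node_iff)
    ultimately show ?thesis by (simp add: rtrancl.rtrancl_into_rtrancl)
  qed simp
qed simp

subsection \<open>Grafting and splitting\<close>

primrec graft :: "ptree \<Rightarrow> ptree \<Rightarrow> ptree" where
  "graft Leaf s = s"
| "graft (Node l r) s = Node l (graft r s)"

primrec split_tree :: "ptree \<Rightarrow> nat \<Rightarrow> ptree \<times> ptree" where
  "split_tree Leaf i = (Leaf, Leaf)"
| "split_tree (Node a c) i =
     (if i \<le> nnodes a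
      then (case split_tree a i of (a0, a1) \<Rightarrow> (a0, Node a1 c))
      else (case split_tree c (i - nnodes a - 1) of (c0, c1) \<Rightarrow> (Node a c0, c1)))"

lemma nnodes_graft [simp]: "nnodes (graft t s) = nnodes t + nnodes s"
  by (induction t) auto

lemma graft_Leaf [simp]: "graft t Leaf = t"
  by (induction t) auto

lemma nnodes_split_tree:
  "i \<le> nnodes t \<Longrightarrow> nnodes (fst (split_tree t i)) = i \<and> nnodes (snd (split_tree t i)) = nnodes t - i"
proof (induction t arbitrary: i)
  case (Node a c)
  show ?case
  proof (cases "i \<le> nnodes a")
    case True
    then show ?thesis using Node.IH(1)[of i] by (auto split: prod.splits)
  next
    case False
    then show ?thesis using Node.IH(2)[of "i - nnodes a - 1"] Node.prems
      by (auto split: prod.splits)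
  qed
qed simp

lemma edges_split_tree:
  "i \<le> nnodes t \<Longrightarrow> edges (fst (split_tree t i)) \<subseteq> (edges t)\<^sup>*"
proof (induction t arbitrary: i)
  case (Node a c)
  show ?case
  proof (cases "i \<le> nnodes a")
    case True
    then show ?thesis using Node.IH(1)[of i] edges_left[of a c]
      by (auto split: prod.splits)
  next
    case False
    define k where "k = i - nnodes a - 1"
    define c0 where "c0 = fst (split_tree c k)"
    have k: "k \<le> nnodes c" using False Node.prems by (auto simp: k_def)
    have fst_split: "fst (split_tree (Node a c) i) = Node a c0"
      using False by (auto simp: c0_def k_def split: prod.splits)
    have IH: "edges c0 \<subseteq> (edges c)\<^sup>*" using Node.IH(2)[OF k] by (simp add: c0_def)
    have sub: "nnodes c0 \<le> nnodes c" using nnodes_split_tree[OF k] k by (simp add: c0_def)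
    let ?p = "Suc (nnodes a)"
    have "(u, v) \<in> (edges (Node a c))\<^sup>*" if "(u, v) \<in> edges (Node a c0)" for u v
    proof -
      from that consider
          "(u, v) \<in> edges a"
        | u' v' where "u = ?p + u'" "v = ?p + v'" "(u', v') \<in> edges c0"
        | "a \<noteq> Leaf" "u = root_node a" "v = ?p"
        | "c0 \<noteq> Leaf" "u = ?p + root_node c0" "v = ?p"
        unfolding edges_Node_iff by blast
      then show ?thesis
      proof cases
        case 1
        then show ?thesis using edges_left[of a c] by blast
      next
        case 2
        then show ?thesis using IH edges_shift[of u' v' c a] by blast
      next
        case 3
        then show ?thesis by (simp add: edges_Node_iff r_into_rtrancl)
      next
        case 4
        then show ?thesis
          using node_le_root[of u "Node a c"] root_node_bounds[of c0] sub by simp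
      qed
    qed
    then show ?thesis unfolding fst_split by auto
  qed
qed simp

lemma edges_graft:
  "(i, j) \<in> edges (graft t s) \<Longrightarrow> i \<le> nnodes t \<Longrightarrow> (i, j) \<in> edges t"
proof (induction t arbitrary: i j)
  case Leaf
  then show ?case using edges_bounds[of i j s] by auto
next
  case (Node a c)
  let ?p = "Suc (nnodes a)"
  have "(i, j) \<in> edges (Node a (graft c s))" using Node.prems(1) by simp
  then consider
      "(i, j) \<in> edges a"
    | i' j' where "i = ?p + i'" "j = ?p + j'" "(i', j') \<in> edges (graft c s)"
    | "a \<noteq> Leaf" "i = root_node a" "j = ?p"
    | "graft c s \<noteq> Leaf" "i = ?p + root_node (graft c s)" "j = ?p"
    unfolding edges_Node_iff by blast
  then show ?case
  proof cases
    case 2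
    then have "(i', j') \<in> edges c" using Node.IH(2) Node.prems(2) by simp
    then show ?thesis using 2 by (simp add: edges_Node_iff)
  next
    case 4
    then have "c \<noteq> Leaf" using Node.prems(2) root_node_bounds[of s] by (cases c) auto
    then have "root_node (graft c s) = root_node c" by (cases c) auto
    then show ?thesis using 4 \<open>c \<noteq> Leaf\<close> by (simp add: edges_Node_iff)
  qed (simp_all add: edges_Node_iff)
qed


section \<open>Bi-leveled trees\<close>

definition bileveled :: "ptree \<Rightarrow> nat set \<Rightarrow> bool" where
  "bileveled t T \<longleftrightarrow>
     nnodes t \<ge> 1 \<and> T \<subseteq> {1..nnodes t} \<and>
     (\<forall>i\<in>T. \<forall>j. node_le t i j \<longrightarrow> j \<in> T) \<and>
     1 \<in> T \<and> (\<forall>i\<in>T. node_le t i 1 \<longrightarrow> i = 1)"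

typedef bltree = "{(t, T). bileveled t T}"
proof
  show "(Node Leaf Leaf, {1}) \<in> {(t, T). bileveled t T}"
    by (auto simp: bileveled_def node_le_def edges_Node_single)
qed

definition tree_of :: "bltree \<Rightarrow> ptree" where
  "tree_of b = fst (Rep_bltree b)"

definition ideal_of :: "bltree \<Rightarrow> nat set" where
  "ideal_of b = snd (Rep_bltree b)"

lemma bileveled_bltree: "bileveled (tree_of b) (ideal_of b)"
  using Rep_bltree[of b] by (auto simp: tree_of_def ideal_of_def)

lemma bltree_eqI: "tree_of b = tree_of c \<Longrightarrow> ideal_of b = ideal_of c \<Longrightarrow> b = c"
  by (metis Rep_bltree_inject prod.expand tree_of_def ideal_of_def)

lemma Abs_bltree_sel:
  assumes "bileveled t T"
  shows "tree_of (Abs_bltree (t, T)) = t" "ideal_of (Abs_bltree (t, T)) = T"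
  using assms by (auto simp: tree_of_def ideal_of_def Abs_bltree_inverse)

definition bl_degree :: "bltree \<Rightarrow> nat" where
  "bl_degree b = nnodes (tree_of b)"

lemma bl_degree_pos: "bl_degree b \<ge> 1"
  using bileveled_bltree[of b] by (simp add: bl_degree_def bileveled_def)

lemma finite_bltrees: "finite {b. bl_degree b = n}"
proof (rule finite_imageD)
  have "Rep_bltree b \<in> {t. nnodes t = n} \<times> Pow {1..n}" if "bl_degree b = n" for b
  proof -
    have "fst (Rep_bltree b) \<in> {t. nnodes t = n}" "snd (Rep_bltree b) \<in> Pow {1..n}"
      using bileveled_bltree[of b] that
      by (simp_all add: bl_degree_def bileveled_def tree_of_def ideal_of_def)
    then show ?thesis by (simp add: mem_Times_iff)
  qed
  then have "Rep_bltree ` {b. bl_degree b = n} \<subseteq> {t. nnodes t = n} \<times> Pow {1..n}" by blast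
  then show "finite (Rep_bltree ` {b. bl_degree b = n})"
    by (rule finite_subset) (simp add: finite_trees)
  show "inj_on Rep_bltree {b. bl_degree b = n}"
    by (simp add: inj_on_def Rep_bltree_inject)
qed

instantiation bltree :: order
begin

definition less_eq_bltree :: "bltree \<Rightarrow> bltree \<Rightarrow> bool" where
  "b \<le> c \<longleftrightarrow> tree_of b \<le> tree_of c \<and> ideal_of b \<supseteq> ideal_of c"

definition less_bltree :: "bltree \<Rightarrow> bltree \<Rightarrow> bool" where
  "b < c \<longleftrightarrow> b \<le> c \<and> \<not> c \<le> (b :: bltree)"

instance
  by intro_classes (auto simp: less_eq_bltree_def less_bltree_def intro: bltree_eqI)

end

instance bltree :: locally_finite_order
proof
  fix x y :: bltree
  show "finite {x..y}"
    by (rule finite_subset[OF _ finite_bltrees[of "bl_degree x"]])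
       (auto simp: less_eq_bltree_def bl_degree_def intro: le_nnodes[symmetric])
qed

definition bl_graft :: "bltree \<Rightarrow> ptree \<Rightarrow> bltree"  (infixl "\<setminus>" 70) where
  "c \<setminus> s = Abs_bltree (graft (tree_of c) s, ideal_of c)"

lemma bileveled_graft:
  assumes "bileveled t T"
  shows "bileveled (graft t s) T"
proof -
  have in_t: "(i, j) \<in> (edges t)\<^sup>* \<and> j \<le> nnodes t"
    if "(i, j) \<in> (edges (graft t s))\<^sup>*" "i \<le> nnodes t" for i j
    using that
  proof (induction rule: rtrancl_induct)
    case (step y z)
    then have "(y, z) \<in> edges t" using edges_graft[of y z t s] by auto
    with step edges_bounds[of y z t] show ?case by (auto intro: rtrancl_into_rtrancl)
  qed simp
  have "node_le t i j" if "node_le (graft t s) i j" "i \<in> T" for i j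
    using in_t[of i j] that assms by (auto simp: node_le_def bileveled_def)
  moreover have "T \<subseteq> {1..nnodes (graft t s)}"
    using assms by (fastforce simp: bileveled_def)
  ultimately show ?thesis
    using assms unfolding bileveled_def by (metis nnodes_graft trans_le_add1)
qed

lemma bl_graft_sel [simp]:
  "tree_of (c \<setminus> s) = graft (tree_of c) s" "ideal_of (c \<setminus> s) = ideal_of c"
  unfolding bl_graft_def
  by (rule Abs_bltree_sel, rule bileveled_graft, rule bileveled_bltree)+

definition indecomposable :: "bltree \<Rightarrow> bool" where
  "indecomposable b \<longleftrightarrow> (\<forall>c s. b = c \<setminus> s \<longrightarrow> c = b \<and> s = Leaf)"

typedef indec = "{b. indecomposable b}"
proof
  let ?b = "Abs_bltree (Node Leaf Leaf, {1})"
  have "bileveled (Node Leaf Leaf) {1}"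
    by (auto simp: bileveled_def node_le_def edges_Node_single)
  then have t: "tree_of ?b = Node Leaf Leaf" by (rule Abs_bltree_sel)
  have "c = ?b \<and> s = Leaf" if "?b = c \<setminus> s" for c s
  proof -
    have "nnodes (tree_of c) + nnodes s = nnodes (tree_of ?b)" unfolding that by simp
    then have "nnodes (tree_of c) + nnodes s = 1" unfolding t by simp
    moreover have "nnodes (tree_of c) \<ge> 1" using bl_degree_pos[of c] by (simp add: bl_degree_def)
    ultimately have "nnodes s = 0" by linarith
    then have "s = Leaf" by simp
    with that show ?thesis by (auto intro: bltree_eqI)
  qed
  then show "?b \<in> {b. indecomposable b}" by (auto simp: indecomposable_def)
qed

text \<open>The left part of the splitting along leaf \<open>i\<close>; it is a bi-leveled tree for \<open>i \<ge> 1\<close>.\<close>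

definition bl_left :: "bltree \<Rightarrow> nat \<Rightarrow> bltree" where
  "bl_left b i = Abs_bltree (fst (split_tree (tree_of b) i), ideal_of b \<inter> {1..i})"

lemma bl_left_sel:
  assumes "1 \<le> i" "i \<le> bl_degree b"
  shows "tree_of (bl_left b i) = fst (split_tree (tree_of b) i)"
    and "ideal_of (bl_left b i) = ideal_of b \<inter> {1..i}"
proof -
  let ?t = "fst (split_tree (tree_of b) i)"
  have n: "nnodes ?t = i" using assms nnodes_split_tree by (auto simp: bl_degree_def)
  have le: "node_le (tree_of b) j k" if "node_le ?t j k" for j k
    using that rtrancl_mono[OF edges_split_tree[of i "tree_of b"]] assms
    by (auto simp: node_le_def bl_degree_def)
  have bd: "k \<in> {1..i}" if "node_le ?t j k" "j \<in> {1..i}" for j k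
    using that(1) unfolding node_le_def
  proof (induction rule: rtrancl_induct)
    case base
    show ?case by (rule that(2))
  next
    case (step y z)
    then show ?case using edges_bounds[of y z ?t] n by simp
  qed
  have "bileveled ?t (ideal_of b \<inter> {1..i})"
    unfolding bileveled_def
  proof (intro conjI ballI allI impI)
    show "j \<in> ideal_of b \<inter> {1..i}" if "k \<in> ideal_of b \<inter> {1..i}" "node_le ?t k j" for k j
      using bileveled_bltree[of b] le[of k j] bd[of k j] that by (auto simp: bileveled_def)
    show "k = 1" if "k \<in> ideal_of b \<inter> {1..i}" "node_le ?t k 1" for k
      using bileveled_bltree[of b] le[of k 1] that by (auto simp: bileveled_def)
  qed (use bileveled_bltree[of b] n assms in \<open>auto simp: bileveled_def\<close>)
  from Abs_bltree_sel[OF this]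
  show "tree_of (bl_left b i) = ?t" "ideal_of (bl_left b i) = ideal_of b \<inter> {1..i}"
    by (simp_all add: bl_left_def)
qed


section \<open>Rational vector spaces with a basis\<close>

text \<open>
  The space with basis \<open>'a\<close> is \<open>'a qvec\<close>, with basis vectors \<open>bvec a\<close>. The tensor product of
  \<open>'a qvec\<close> and \<open>'b qvec\<close> is \<open>('a \<times> 'b) qvec\<close>, with the bilinear map \<open>tensor\<close>.
\<close>

type_synonym 'a qvec = "'a \<Rightarrow>\<^sub>0 rat"

abbreviation bvec :: "'a \<Rightarrow> 'a qvec" where
  "bvec a \<equiv> Poly_Mapping.single a 1"

definition qscale :: "rat \<Rightarrow> 'a qvec \<Rightarrow> 'a qvec" where
  "qscale c x = Poly_Mapping.map ((*) c) x"

lemma lookup_qscale [simp]: "Poly_Mapping.lookup (qscale c x) a = c * Poly_Mapping.lookup x a"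
  by (simp add: qscale_def Poly_Mapping.map.rep_eq when_def)

lemma vector_space_qscale: "vector_space qscale"
  by unfold_locales (auto intro!: poly_mapping_eqI simp: lookup_add algebra_simps)

abbreviation qlinear :: "('a qvec \<Rightarrow> 'b qvec) \<Rightarrow> bool" where
  "qlinear \<equiv> Vector_Spaces.linear qscale qscale"

definition lin_ext :: "('a \<Rightarrow> 'b qvec) \<Rightarrow> 'a qvec \<Rightarrow> 'b qvec" where
  "lin_ext f x = (\<Sum>a\<in>Poly_Mapping.keys x. qscale (Poly_Mapping.lookup x a) (f a))"

lemma lin_ext_bvec [simp]: "lin_ext f (bvec a) = f a"
  by (auto simp: lin_ext_def intro!: poly_mapping_eqI)

lemma lin_ext_superset:
  assumes "finite A" "Poly_Mapping.keys x \<subseteq> A"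
  shows "lin_ext f x = (\<Sum>a\<in>A. qscale (Poly_Mapping.lookup x a) (f a))"
  unfolding lin_ext_def
  by (rule sum.mono_neutral_left) (use assms in \<open>auto intro!: poly_mapping_eqI simp: in_keys_iff\<close>)

lemma qlinear_lin_ext:
  fixes f :: "'a \<Rightarrow> 'b qvec"
  shows "qlinear (lin_ext f)"
proof -
  show ?thesis
  proof (rule Vector_Spaces.linear.intro[OF vector_space_qscale vector_space_qscale],
      unfold_locales)
    fix x y :: "'a qvec"
    let ?A = "Poly_Mapping.keys x \<union> Poly_Mapping.keys y"
    have "lin_ext f (x + y) = (\<Sum>a\<in>?A. qscale (Poly_Mapping.lookup (x + y) a) (f a))"
      by (rule lin_ext_superset) (simp_all add: Poly_Mapping.keys_add)
    also have "\<dots> = (\<Sum>a\<in>?A. qscale (Poly_Mapping.lookup x a) (f a)) + (\<Sum>a\<in>?A. qscale (Poly_Mapping.lookup y a) (f a))"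
      by (rule poly_mapping_eqI) (simp add: lookup_add lookup_sum sum.distrib algebra_simps)
    also have "\<dots> = lin_ext f x + lin_ext f y"
      by (simp add: lin_ext_superset[symmetric])
    finally show "lin_ext f (x + y) = lin_ext f x + lin_ext f y" .
  next
    fix c and x :: "'a qvec"
    have "lin_ext f (qscale c x) = (\<Sum>a\<in>Poly_Mapping.keys x. qscale (Poly_Mapping.lookup (qscale c x) a) (f a))"
      by (rule lin_ext_superset) (auto simp: in_keys_iff)
    then show "lin_ext f (qscale c x) = qscale c (lin_ext f x)"
      by (auto intro!: poly_mapping_eqI simp: lin_ext_def lookup_sum sum_distrib_left mult_ac)
  qed (auto intro!: poly_mapping_eqI simp: lookup_add algebra_simps)
qed

definition tensor :: "'a qvec \<Rightarrow> 'b qvec \<Rightarrow> ('a \<times> 'b) qvec"  (infixr "\<otimes>" 75) where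
  "x \<otimes> y = (\<Sum>a\<in>Poly_Mapping.keys x. \<Sum>b\<in>Poly_Mapping.keys y. Poly_Mapping.single (a, b) (Poly_Mapping.lookup x a * Poly_Mapping.lookup y b))"

lemma lookup_tensor: "Poly_Mapping.lookup (x \<otimes> y) (a, b) = Poly_Mapping.lookup x a * Poly_Mapping.lookup y b"
proof -
  have "Poly_Mapping.lookup (x \<otimes> y) (a, b) =
      (\<Sum>a'\<in>Poly_Mapping.keys x. \<Sum>b'\<in>Poly_Mapping.keys y. if a' = a then if b' = b then Poly_Mapping.lookup x a * Poly_Mapping.lookup y b else 0 else 0)"
    unfolding tensor_def lookup_sum by (intro sum.cong refl) (auto simp: lookup_single when_def)
  also have "\<dots> = (\<Sum>a'\<in>Poly_Mapping.keys x. if a' = a then \<Sum>b'\<in>Poly_Mapping.keys y. if b' = b then Poly_Mapping.lookup x a * Poly_Mapping.lookup y b else 0 else 0)"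
    by (intro sum.cong refl) auto
  also have "\<dots> = Poly_Mapping.lookup x a * Poly_Mapping.lookup y b"
    by (simp add: in_keys_iff)
  finally show ?thesis .
qed

lemma tensor_bvec [simp]: "bvec a \<otimes> bvec b = bvec (a, b)"
  by (simp add: tensor_def)

definition tensor_map ::
    "('a qvec \<Rightarrow> 'c qvec) \<Rightarrow> ('b qvec \<Rightarrow> 'd qvec) \<Rightarrow> ('a \<times> 'b) qvec \<Rightarrow> ('c \<times> 'd) qvec" where
  "tensor_map f g = lin_ext (\<lambda>(a, b). f (bvec a) \<otimes> g (bvec b))"

definition reassoc :: "('a \<times> 'b \<times> 'c) qvec \<Rightarrow> (('a \<times> 'b) \<times> 'c) qvec" where
  "reassoc = lin_ext (\<lambda>(a, b, c). bvec ((a, b), c))"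

text \<open>For linear functionals \<open>f\<close>, the maps \<open>f \<otimes> id\<close> and \<open>id \<otimes> f\<close>, followed by the
  canonical identification of a tensor product with the ground field.\<close>

definition contract_left :: "('a qvec \<Rightarrow> rat) \<Rightarrow> ('a \<times> 'b) qvec \<Rightarrow> 'b qvec" where
  "contract_left f = lin_ext (\<lambda>(a, b). qscale (f (bvec a)) (bvec b))"

definition contract_right :: "('b qvec \<Rightarrow> rat) \<Rightarrow> ('a \<times> 'b) qvec \<Rightarrow> 'a qvec" where
  "contract_right f = lin_ext (\<lambda>(a, b). qscale (f (bvec b)) (bvec a))"

text \<open>A degree function on the basis grades the space.\<close>

definition homogeneous :: "('a \<Rightarrow> nat) \<Rightarrow> nat \<Rightarrow> 'a qvec set" where
  "homogeneous deg n = {x. \<forall>a\<in>Poly_Mapping.keys x. deg a = n}"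

definition deg_pair :: "('a \<Rightarrow> nat) \<Rightarrow> ('b \<Rightarrow> nat) \<Rightarrow> 'a \<times> 'b \<Rightarrow> nat" where
  "deg_pair d e = (\<lambda>(a, b). d a + e b)"

definition graded_map ::
    "('a \<Rightarrow> nat) \<Rightarrow> ('b \<Rightarrow> nat) \<Rightarrow> ('a qvec \<Rightarrow> 'b qvec) \<Rightarrow> bool" where
  "graded_map d e f \<longleftrightarrow> (\<forall>n. f ` homogeneous d n \<subseteq> homogeneous e n)"


section \<open>Graded coalgebras and comodules\<close>

locale graded_coalgebra =
  fixes deg :: "'c \<Rightarrow> nat"
    and comult :: "'c qvec \<Rightarrow> ('c \<times> 'c) qvec"
    and counit :: "'c qvec \<Rightarrow> rat"
  assumes linear_comult: "qlinear comult"
    and linear_counit: "Vector_Spaces.linear qscale (*) counit"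
    and coassoc: "tensor_map comult id (comult x) = reassoc (tensor_map id comult (comult x))"
    and counit_left: "contract_left counit (comult x) = x"
    and counit_right: "contract_right counit (comult x) = x"
    and graded_comult: "graded_map deg (deg_pair deg deg) comult"
    and graded_counit: "x \<in> homogeneous deg n \<Longrightarrow> n \<noteq> 0 \<Longrightarrow> counit x = 0"

locale graded_right_comodule = graded_coalgebra deg comult counit
  for deg :: "'c \<Rightarrow> nat" and comult counit +
  fixes vdeg :: "'v \<Rightarrow> nat"
    and coact :: "'v qvec \<Rightarrow> ('v \<times> 'c) qvec"
  assumes linear_coact: "qlinear coact"
    and coact_coassoc: "tensor_map coact id (coact v) = reassoc (tensor_map id comult (coact v))"
    and coact_counit: "contract_right counit (coact v) = v"
    and graded_coact: "graded_map vdeg (deg_pair vdeg deg) coact"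

locale graded_right_comodule_iso =
  source: graded_right_comodule deg comult counit vdeg vcoact +
  target: graded_right_comodule deg comult counit wdeg wcoact
  for deg :: "'c \<Rightarrow> nat" and comult counit
    and vdeg :: "'v \<Rightarrow> nat" and vcoact
    and wdeg :: "'w \<Rightarrow> nat" and wcoact +
  fixes f :: "'v qvec \<Rightarrow> 'w qvec"
  assumes linear: "qlinear f"
    and bij: "bij f"
    and graded: "graded_map vdeg wdeg f"
    and colinear: "wcoact (f v) = tensor_map f id (vcoact v)"


section \<open>The coalgebra of planar binary trees and its comodules\<close>

text \<open>
  The basis elements written \<open>F\<close> are the \<open>bvec\<close>s; on trees and on bi-leveled trees \<open>mvec\<close>
  gives the second basis, written \<open>M\<close>. Since trees with different numbers of nodes are
  incomparable, the sum runs over a finite set.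
\<close>

definition mvec :: "'a::locally_finite_order \<Rightarrow> 'a qvec" where
  "mvec x = (\<Sum>y\<in>{x..}. Poly_Mapping.single y (mobius x y))"

lemma finite_atLeast_ptree: "finite {t :: ptree..}"
  by (rule finite_subset[OF _ finite_trees[of "nnodes t"]]) (auto intro: le_nnodes[symmetric])

lemma finite_atLeast_bltree: "finite {b :: bltree..}"
  by (rule finite_subset[OF _ finite_bltrees[of "bl_degree b"]])
     (auto simp: less_eq_bltree_def bl_degree_def intro: le_nnodes[symmetric])

definition Delta :: "ptree qvec \<Rightarrow> (ptree \<times> ptree) qvec" where
  "Delta = lin_ext (\<lambda>t. \<Sum>i\<le>nnodes t. bvec (fst (split_tree t i)) \<otimes> bvec (snd (split_tree t i)))"

definition epsilon :: "ptree qvec \<Rightarrow> rat" where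
  "epsilon x = Poly_Mapping.lookup x Leaf"

definition rho :: "bltree qvec \<Rightarrow> (bltree \<times> ptree) qvec" where
  "rho = lin_ext (\<lambda>b. \<Sum>i | i \<le> bl_degree b \<and> fst (split_tree (tree_of b) i) \<noteq> Leaf.
           bvec (bl_left b i) \<otimes> bvec (snd (split_tree (tree_of b) i)))"

definition indec_degree :: "indec \<Rightarrow> nat" where
  "indec_degree b = bl_degree (Rep_indec b)"

definition cofree_coact :: "(indec \<times> ptree) qvec \<Rightarrow> ((indec \<times> ptree) \<times> ptree) qvec" where
  "cofree_coact x = reassoc (tensor_map id Delta x)"

lemma cofree_coact_tensor: "cofree_coact (bvec b \<otimes> y) = reassoc (bvec b \<otimes> Delta y)"
proof -
  have "tensor_map id Delta (bvec b \<otimes> y) = bvec b \<otimes> Delta y"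
  proof (rule poly_mapping_eqI)
    fix k :: "indec \<times> ptree \<times> ptree"
    obtain c t where k: "k = (c, t)" by (cases k)
    have "Poly_Mapping.keys (bvec b \<otimes> y) \<subseteq> Pair b ` Poly_Mapping.keys y"
      by (auto simp: in_keys_iff lookup_tensor lookup_single when_def split: if_splits)
    then have "tensor_map id Delta (bvec b \<otimes> y) =
        (\<Sum>a\<in>Pair b ` Poly_Mapping.keys y. qscale (Poly_Mapping.lookup (bvec b \<otimes> y) a) ((\<lambda>(a, t). id (bvec a) \<otimes> Delta (bvec t)) a))"
      unfolding tensor_map_def by (intro lin_ext_superset) auto
    also have "\<dots> = (\<Sum>s\<in>Poly_Mapping.keys y. qscale (Poly_Mapping.lookup y s) (bvec b \<otimes> Delta (bvec s)))"
      by (subst sum.reindex) (auto simp: inj_on_def lookup_tensor)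
    finally have *: "tensor_map id Delta (bvec b \<otimes> y) = \<dots>" .
    have "Poly_Mapping.lookup (Delta y) t = (\<Sum>s\<in>Poly_Mapping.keys y. Poly_Mapping.lookup y s * Poly_Mapping.lookup (Delta (bvec s)) t)"
      unfolding Delta_def lin_ext_bvec by (simp add: lin_ext_def lookup_sum)
    then show "Poly_Mapping.lookup (tensor_map id Delta (bvec b \<otimes> y)) k = Poly_Mapping.lookup (bvec b \<otimes> Delta y) k"
      by (simp add: * k lookup_sum lookup_tensor sum_distrib_left mult_ac)
  qed
  then show ?thesis by (simp add: cofree_coact_def)
qed


section \<open>Enumerating series\<close>

definition bl_series :: "rat fps" where
  "bl_series = Abs_fps (\<lambda>n. of_nat (card {b. bl_degree b = n}))"

definition tree_series :: "rat fps" where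
  "tree_series = Abs_fps (\<lambda>n. of_nat (card {t. nnodes t = n}))"

definition indec_series :: "rat fps" where
  "indec_series = Abs_fps (\<lambda>n. of_nat (card {b. indecomposable b \<and> bl_degree b = n}))"

end

theory Submission
  imports Defs
begin

text \<open>
  Two facts carry the proof. The first is an adjunction. Splitting a tree \<open>t\<close> along leaf \<open>i\<close> and
  grafting onto the rightmost leaf are adjoint for the Tamari order: among the trees
  \<open>graft r s\<close> with \<open>r\<close> of \<open>i\<close> nodes, those above \<open>t\<close> are exactly those with
  \<open>r\<close> above the left part and \<open>s\<close> above the right part of \<open>t\<close> (\<open>le_graft_iff\<close>). The order
  ideal of a bi-leveled tree is only restricted by a splitting and is kept by a grafting, so the same
  holds for bi-leveled trees (\<open>le_bl_graft_iff\<close>). Since a basis vector \<open>F\<close> is the sum of the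
  vectors \<open>M\<close> above it, Moebius inversion turns the sum over splittings that defines a coaction on
  the basis \<open>F\<close> into a sum over factorizations on the basis \<open>M\<close> (\<open>coact_mvec\<close>):
  the coaction sends \<open>M\<close> of \<open>b\<close> to the sum of \<open>M\<close> of \<open>c\<close> tensor \<open>M\<close> of \<open>s\<close>
  over all \<open>b = c \<setminus> s\<close>. The comodule axioms for all the spaces involved then reduce to
  associativity and unitality of grafting.

  The second fact is that every bi-leveled tree is \<open>b \<setminus> s\<close> for a unique indecomposable
  \<open>b\<close> and a unique \<open>s\<close> (\<open>bij_factorization\<close>), so the map in question carries a basis to
  a basis. Moreover, an indecomposable left factor is contained in the left factor of every other
  factorization: if \<open>b \<setminus> s = c \<setminus> u\<close>, then \<open>c = b \<setminus> r\<close> and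
  \<open>s = graft r u\<close> (\<open>indecomposable_prefix\<close>). Hence the factorizations of \<open>b \<setminus> s\<close> are
  those of \<open>s\<close> multiplied on the left by \<open>b\<close>, which is colinearity. Counting the unique
  factorizations by degree gives the product formula for the enumerating series.
\<close>

section \<open>Linear maps between spaces with a basis\<close>

lemma qlinear_iff:
  fixes f :: "'a qvec \<Rightarrow> 'b qvec"
  shows "qlinear f \<longleftrightarrow> (\<forall>x y. f (x + y) = f x + f y) \<and> (\<forall>c x. f (qscale c x) = qscale c (f x))"
proof -
  interpret a: vector_space "qscale :: _ \<Rightarrow> 'a qvec \<Rightarrow> _" by (rule vector_space_qscale)
  interpret b: vector_space "qscale :: _ \<Rightarrow> 'b qvec \<Rightarrow> _" by (rule vector_space_qscale)
  show ?thesis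
    by (simp add: Vector_Spaces.linear_def module_hom_iff vector_space_qscale a.module_axioms b.module_axioms)
qed

lemma qlinear_add: "qlinear f \<Longrightarrow> f (x + y) = f x + f y"
  and qlinear_scale: "qlinear f \<Longrightarrow> f (qscale c x) = qscale c (f x)"
  by (auto simp: qlinear_iff)

lemma qscale_0_left [simp]: "qscale 0 x = 0"
  and qscale_1 [simp]: "qscale 1 x = x"
  and qscale_0_right [simp]: "qscale c 0 = 0"
  by (auto intro: poly_mapping_eqI)

lemma qscale_sum_right: "qscale c (sum f A) = (\<Sum>a\<in>A. qscale c (f a))"
  and qscale_sum_left: "qscale (sum g A) x = (\<Sum>a\<in>A. qscale (g a) x)"
  by (auto intro!: poly_mapping_eqI
      simp: lookup_add lookup_sum algebra_simps sum_distrib_left sum_distrib_right)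

lemma single_conv_bvec: "Poly_Mapping.single a c = qscale c (bvec a)"
  by (rule poly_mapping_eqI) (simp add: lookup_single when_def)

lemma qlinear_0: "qlinear f \<Longrightarrow> f 0 = 0"
  using qlinear_scale[of f 0 0] by simp

lemma qlinear_sum: "qlinear f \<Longrightarrow> f (sum g A) = (\<Sum>a\<in>A. f (g a))"
  by (induction A rule: infinite_finite_induct) (simp_all add: qlinear_0 qlinear_add)

lemma qlinear_id: "qlinear id" "qlinear (\<lambda>x. x)"
  by (simp_all add: qlinear_iff)

lemma qlinear_comp: "qlinear f \<Longrightarrow> qlinear g \<Longrightarrow> qlinear (\<lambda>x. f (g x))"
  by (simp add: qlinear_iff)

lemma qvec_expand: "x = (\<Sum>a\<in>Poly_Mapping.keys x. qscale (Poly_Mapping.lookup x a) (bvec a))"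
  by (rule poly_mapping_eqI)
     (auto simp: lookup_sum lookup_single when_def in_keys_iff if_distrib cong: if_cong)

lemma qlinear_conv_lin_ext: "qlinear f \<Longrightarrow> f = lin_ext (\<lambda>a. f (bvec a))"
  by (rule ext, subst qvec_expand) (simp add: qlinear_sum qlinear_scale lin_ext_def)

lemma qlinear_eqI: "qlinear f \<Longrightarrow> qlinear g \<Longrightarrow> (\<And>a. f (bvec a) = g (bvec a)) \<Longrightarrow> f = g"
  by (subst (1 2) qlinear_conv_lin_ext) simp_all

lemma tensor_eqI:
  "(\<And>a b. Poly_Mapping.lookup x (a, b) = Poly_Mapping.lookup y (a, b)) \<Longrightarrow> x = y"
  by (rule poly_mapping_eqI) auto

lemma qlinear_tensor_left: "qlinear (\<lambda>x. x \<otimes> y)"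
  and qlinear_tensor_right: "qlinear (\<lambda>y. x \<otimes> y)"
  by (auto simp: qlinear_iff lookup_tensor lookup_add algebra_simps intro!: tensor_eqI)

lemmas tensor_sum_left = qlinear_sum[OF qlinear_tensor_left]
  and tensor_sum_right = qlinear_sum[OF qlinear_tensor_right]

lemma tensor_sum_sum: "sum f A \<otimes> sum g B = (\<Sum>(a, b)\<in>A \<times> B. f a \<otimes> g b)"
  unfolding tensor_sum_left unfolding tensor_sum_right by (rule sum.cartesian_product)

lemma qlinear_tensor_map: "qlinear (tensor_map f g)"
  unfolding tensor_map_def by (rule qlinear_lin_ext)

lemma qlinear_reassoc: "qlinear reassoc"
  unfolding reassoc_def by (rule qlinear_lin_ext)

lemma qlinear_contract_left: "qlinear (contract_left f)"
  and qlinear_contract_right: "qlinear (contract_right f)"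
  unfolding contract_left_def contract_right_def by (rule qlinear_lin_ext)+

text \<open>
  Identities between maps on a tensor product are reduced to basis vectors one argument at a time,
  so that they become available on the vectors \<open>x \<otimes> y\<close> for arbitrary \<open>x\<close> and \<open>y\<close>.
\<close>

lemma bilinear_eqI:
  fixes h k :: "'a qvec \<Rightarrow> 'b qvec \<Rightarrow> 'c qvec"
  assumes "\<And>y. qlinear (\<lambda>x. h x y)" "\<And>x. qlinear (h x)"
    and "\<And>y. qlinear (\<lambda>x. k x y)" "\<And>x. qlinear (k x)"
    and "\<And>a b. h (bvec a) (bvec b) = k (bvec a) (bvec b)"
  shows "h x y = k x y"
proof -
  have "h (bvec a) = k (bvec a)" for a
    by (rule qlinear_eqI) (use assms in auto)
  then have "(\<lambda>x. h x y) = (\<lambda>x. k x y)"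
    by (intro qlinear_eqI) (use assms in auto)
  then show ?thesis by metis
qed

lemma tensor_map_bvec [simp]: "tensor_map f g (bvec (a, b)) = f (bvec a) \<otimes> g (bvec b)"
  and reassoc_bvec [simp]: "reassoc (bvec (a, b', c)) = bvec ((a, b'), c)"
  and contract_left_bvec [simp]: "contract_left \<phi> (bvec (a', b)) = qscale (\<phi> (bvec a')) (bvec b)"
  and contract_right_bvec [simp]: "contract_right \<psi> (bvec (a, b)) = qscale (\<psi> (bvec b)) (bvec a)"
  by (simp_all add: tensor_map_def reassoc_def contract_left_def contract_right_def)

lemmas qlinear_intros = qlinear_tensor_left qlinear_tensor_right
  qlinear_comp[OF qlinear_tensor_left] qlinear_comp[OF qlinear_tensor_right]
  qlinear_comp[OF qlinear_tensor_map] qlinear_comp[OF qlinear_reassoc]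
  qlinear_comp[OF qlinear_contract_left] qlinear_comp[OF qlinear_contract_right]

lemma tensor_map_tensor:
  assumes "qlinear f" "qlinear g"
  shows "tensor_map f g (x \<otimes> y) = f x \<otimes> g y"
  by (rule bilinear_eqI[of "\<lambda>x y. tensor_map f g (x \<otimes> y)" "\<lambda>x y. f x \<otimes> g y"])
     (auto intro!: qlinear_intros assms)

lemma reassoc_tensor: "reassoc (x \<otimes> y \<otimes> z) = (x \<otimes> y) \<otimes> z"
proof -
  have "reassoc (bvec a \<otimes> y \<otimes> z) = (bvec a \<otimes> y) \<otimes> z" for a
    by (rule bilinear_eqI[of "\<lambda>y z. reassoc (bvec a \<otimes> y \<otimes> z)" "\<lambda>y z. (bvec a \<otimes> y) \<otimes> z"])
       (auto intro!: qlinear_intros)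
  then have "(\<lambda>x. reassoc (x \<otimes> y \<otimes> z)) = (\<lambda>x. (x \<otimes> y) \<otimes> z)"
    by (intro qlinear_eqI) (auto intro!: qlinear_intros)
  then show ?thesis by metis
qed

lemma linear_epsilon: "Vector_Spaces.linear qscale (*) epsilon"
proof -
  interpret vector_space "qscale :: _ \<Rightarrow> ptree qvec \<Rightarrow> _" by (rule vector_space_qscale)
  interpret r: vector_space "(*) :: rat \<Rightarrow> _" by unfold_locales (simp_all add: algebra_simps)
  show ?thesis
    by unfold_locales (simp_all add: epsilon_def lookup_add)
qed

lemma contract_left_epsilon: "contract_left epsilon (x \<otimes> y) = qscale (epsilon x) y"
proof (rule bilinear_eqI[of "\<lambda>x y. contract_left epsilon (x \<otimes> y)" "\<lambda>x y. qscale (epsilon x) y"])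
  show "qlinear (\<lambda>x. qscale (epsilon x) y)" "qlinear (qscale (epsilon x))" for x and y :: "'a qvec"
    by (auto simp: qlinear_iff epsilon_def lookup_add algebra_simps intro!: poly_mapping_eqI)
qed (auto intro!: qlinear_intros)

lemma contract_right_epsilon: "contract_right epsilon (x \<otimes> y) = qscale (epsilon y) x"
proof (rule bilinear_eqI[of "\<lambda>x y. contract_right epsilon (x \<otimes> y)" "\<lambda>x y. qscale (epsilon y) x"])
  show "qlinear (qscale (epsilon y))" "qlinear (\<lambda>y. qscale (epsilon y) x)" for y and x :: "'a qvec"
    by (auto simp: qlinear_iff epsilon_def lookup_add algebra_simps intro!: poly_mapping_eqI)
qed (auto intro!: qlinear_intros)

lemma homogeneous_sum: "(\<And>a. a \<in> A \<Longrightarrow> f a \<in> homogeneous d n) \<Longrightarrow> sum f A \<in> homogeneous d n"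
proof (induction A rule: infinite_finite_induct)
  case (insert a A)
  then show ?case
    using Poly_Mapping.keys_add[of "f a" "sum f A"] by (fastforce simp: homogeneous_def)
qed (auto simp: homogeneous_def)

lemma homogeneous_scale: "x \<in> homogeneous d n \<Longrightarrow> qscale c x \<in> homogeneous d n"
  by (auto simp: homogeneous_def in_keys_iff)

lemma homogeneous_bvec: "bvec a \<in> homogeneous d (d a)"
  by (simp add: homogeneous_def)

lemma homogeneous_tensor:
  "x \<in> homogeneous d m \<Longrightarrow> y \<in> homogeneous e n \<Longrightarrow> x \<otimes> y \<in> homogeneous (deg_pair d e) (m + n)"
  by (auto simp: homogeneous_def deg_pair_def in_keys_iff lookup_tensor)

lemma graded_mapI:
  assumes "qlinear f" "\<And>a. f (bvec a) \<in> homogeneous e (d a)"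
  shows "graded_map d e f"
  unfolding graded_map_def
proof (intro allI image_subsetI)
  fix n x assume "x \<in> homogeneous d n"
  then show "f x \<in> homogeneous e n"
    using assms(2)
    by (subst qlinear_conv_lin_ext[OF assms(1)], unfold lin_ext_def)
       (auto simp: homogeneous_def[of d] intro!: homogeneous_sum homogeneous_scale)
qed


section \<open>Moebius inversion\<close>

text \<open>
  Finiteness of the up-sets makes the sum defining \<open>mvec\<close> a genuine finite one; an infinite
  set would silently give the value 0.
\<close>

class upper_finite_order = locally_finite_order +
  assumes finite_atLeast: "finite {x..}"

instance ptree :: upper_finite_order
  by standard (rule finite_atLeast_ptree)

instance bltree :: upper_finite_order
  by standard (rule finite_atLeast_bltree)

lemma sum_mobius: "x \<le> y \<Longrightarrow> (\<Sum>z\<in>{x..y}. mobius x z) = (if x = y then 1 else 0)"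
proof (cases "x = y")
  case True
  then show ?thesis by (simp add: mobius.simps)
next
  case False
  assume "x \<le> y"
  with False have "{x..y} = insert y {x..<y}" "x < y" by auto
  moreover have "finite {x..<y}"
    by (rule finite_subset[OF _ finite_Icc[of x y]]) auto
  ultimately show ?thesis using False by (simp add: mobius.simps[of x y])
qed

text \<open>
  Moebius inversion in the form used throughout: to evaluate a linear map on the vectors
  \<open>M\<close>, it suffices to write its values on the vectors \<open>F\<close> as sums over up-sets. This holds since,
  after exchanging the two sums, \<open>g z\<close> gets the coefficient
  \<open>\<Sum>y\<in>{x..z}. mobius x y\<close>, which vanishes unless \<open>z = x\<close>.
\<close>

lemma qlinear_mvec_eq:
  assumes f: "qlinear f" and eq: "\<And>x. f (bvec x) = (\<Sum>y\<in>{x..}. g y)"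
  shows "f (mvec (x :: 'a::upper_finite_order)) = g x"
proof -
  have "f (mvec x) = (\<Sum>y\<in>{x..}. \<Sum>z\<in>{y..}. qscale (mobius x y) (g z))"
    unfolding mvec_def
    by (subst single_conv_bvec) (simp add: qlinear_sum[OF f] qlinear_scale[OF f] eq qscale_sum_right)
  also have "\<dots> = (\<Sum>z\<in>{x..}. \<Sum>y\<in>{x..z}. qscale (mobius x y) (g z))"
    by (subst (1 2) sum.Sigma)
       (auto intro!: sum.reindex_bij_witness[of _ prod.swap prod.swap]
          simp: finite_atLeast finite_Icc intro: order.trans)
  also have "\<dots> = (\<Sum>z\<in>{x..}. if x = z then g z else 0)"
    by (intro sum.cong refl) (auto simp: qscale_sum_left[symmetric] sum_mobius)
  also have "\<dots> = g x" by (simp add: finite_atLeast)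
  finally show ?thesis .
qed

text \<open>
  The zeta map is unitriangular: the coefficient at a minimal element of the support of \<open>v\<close> is
  left unchanged.
\<close>

lemma zeta_injective:
  fixes v :: "'a::upper_finite_order qvec"
  assumes "lin_ext (\<lambda>x. \<Sum>y\<in>{x..}. bvec y) v = 0"
  shows "v = 0"
proof (rule ccontr)
  assume "v \<noteq> 0"
  then have "Poly_Mapping.keys v \<noteq> {}" by simp
  then obtain a where a: "a \<in> Poly_Mapping.keys v"
    and min: "\<And>x. x \<in> Poly_Mapping.keys v \<Longrightarrow> x \<le> a \<Longrightarrow> x = a"
    using finite_has_minimal[of "Poly_Mapping.keys v"] by auto
  have "0 = (\<Sum>x\<in>Poly_Mapping.keys v. Poly_Mapping.lookup v x * (if x \<le> a then 1 else 0))"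
    using arg_cong[OF assms, of "\<lambda>w. Poly_Mapping.lookup w a"]
    by (simp add: lin_ext_def lookup_sum lookup_single when_def finite_atLeast)
  also have "\<dots> = (\<Sum>x\<in>Poly_Mapping.keys v. if x = a then Poly_Mapping.lookup v x else 0)"
    by (rule sum.cong) (use min in auto)
  also have "\<dots> = Poly_Mapping.lookup v a" using a by simp
  finally show False using a by (simp add: in_keys_iff)
qed

text \<open>
  The recursion for \<open>mobius\<close> sums over the second argument, so it only says directly that the
  Moebius map is a right inverse of the zeta map. Injectivity of the zeta map makes it a two-sided
  inverse.
\<close>

lemma bvec_eq_sum_mvec: "bvec (x :: 'a::upper_finite_order) = (\<Sum>y\<in>{x..}. mvec y)"
proof -
  let ?Z = "lin_ext (\<lambda>x. \<Sum>y\<in>{x..}. bvec y) :: 'a qvec \<Rightarrow> 'a qvec"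
  have Z: "qlinear ?Z" by (rule qlinear_lin_ext)
  have "?Z (mvec y) = bvec y" for y by (rule qlinear_mvec_eq[OF Z]) simp
  then have "?Z (\<Sum>y\<in>{x..}. mvec y) = ?Z (bvec x)" by (simp add: qlinear_sum[OF Z])
  then have "?Z ((\<Sum>y\<in>{x..}. mvec y) + qscale (-1) (bvec x)) = 0"
    unfolding qlinear_add[OF Z] qlinear_scale[OF Z] by (auto intro!: poly_mapping_eqI simp: lookup_add)
  from zeta_injective[OF this] show ?thesis
    by (metis add.inverse_inverse add_eq_0_iff2 mult_minus1 lookup_qscale lookup_uminus poly_mapping_eqI)
qed


lemma homogeneous_mvec:
  assumes "\<And>y. x \<le> y \<Longrightarrow> d x = d y"
  shows "mvec x \<in> homogeneous d (d x)"
  unfolding mvec_def using assms by (intro homogeneous_sum) (auto simp: homogeneous_def)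

lemma epsilon_mvec: "epsilon (mvec s) = (if s = Leaf then 1 else 0)"
proof -
  have "t = Leaf" if "t \<le> Leaf" for t using le_nnodes[OF that] by simp
  then have "epsilon (mvec s) = (\<Sum>t\<in>{s..}. if t = Leaf then mobius s Leaf else 0)"
    by (auto simp: epsilon_def mvec_def lookup_sum lookup_single when_def intro!: sum.cong)
  also have "\<dots> = (if s \<le> Leaf then mobius s Leaf else 0)"
    by (simp add: finite_atLeast)
  also have "\<dots> = (if s = Leaf then 1 else 0)"
    using \<open>\<And>t. t \<le> Leaf \<Longrightarrow> t = Leaf\<close> by (auto simp: mobius.simps)
  finally show ?thesis .
qed


section \<open>Splitting and grafting\<close>

lemma tamari_le_Node: "l \<le> l' \<Longrightarrow> r \<le> r' \<Longrightarrow> Node l r \<le> Node l' r'"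
proof -
  assume "l \<le> l'"
  then have "Node l r \<le> Node l' r"
    unfolding less_eq_ptree_def
    by (induction rule: rtranclp_induct) (auto intro: rtranclp.rtrancl_into_rtrancl tamari_cover.left)
  moreover assume "r \<le> r'"
  then have "Node l' r \<le> Node l' r'"
    unfolding less_eq_ptree_def
    by (induction rule: rtranclp_induct) (auto intro: rtranclp.rtrancl_into_rtrancl tamari_cover.right)
  ultimately show ?thesis by (rule order.trans)
qed

lemma tamari_rotate: "Node (Node x y) z \<le> Node x (Node y z)"
  unfolding less_eq_ptree_def by (rule r_into_rtranclp) (rule tamari_cover.rotate)

lemma graft_mono: "t \<le> t' \<Longrightarrow> s \<le> s' \<Longrightarrow> graft t s \<le> graft t' s'"
proof -
  have cover: "graft u w \<le> graft u' w" if "tamari_cover u u'" for u u' w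
    using that
  proof (induction rule: tamari_cover.induct)
    case (rotate x y z)
    show ?case using tamari_rotate[of x y "graft z w"] by simp
  next
    case (left l l' r)
    then have "l \<le> l'" by (auto simp: less_eq_ptree_def)
    then show ?case by (simp add: tamari_le_Node)
  next
    case (right r r' l)
    then show ?case by (simp add: tamari_le_Node)
  qed
  assume "t \<le> t'"
  then have "graft t s \<le> graft t' s"
    unfolding less_eq_ptree_def[of t t']
    by (induction rule: rtranclp_induct) (auto intro: cover order.trans)
  moreover assume "s \<le> s'"
  then have "graft t' s \<le> graft t' s'"
    by (induction t') (auto intro: tamari_le_Node)
  ultimately show ?thesis by (rule order.trans)
qed

lemma split_graft: "split_tree (graft t s) (nnodes t) = (t, s)"
proof (induction t)
  case Leaf
  show ?case by (induction s) auto
qed auto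

text \<open>
  Regrafting the two parts of a splitting moves the nodes on the right of the cut to the end of the
  right branch, which is a sequence of right rotations.
\<close>

lemma le_graft_split: "t \<le> graft (fst (split_tree t i)) (snd (split_tree t i))"
proof (induction t arbitrary: i)
  case (Node a c)
  have left: "Node (graft x y) c \<le> graft x (Node y c)" for x y
  proof (induction x)
    case (Node p q)
    have "Node (Node p (graft q y)) c \<le> Node p (Node (graft q y) c)" by (rule tamari_rotate)
    also have "\<dots> \<le> Node p (graft q (Node y c))" by (intro tamari_le_Node Node.IH order.refl)
    finally show ?case by simp
  qed simp
  show ?case
    using Node.IH(1)[of i] Node.IH(2)[of "i - nnodes a - 1"] left
    by (auto split: prod.splits intro: tamari_le_Node order.trans)
qed simp

lemma split_mono:
  assumes "t \<le> t'"
  shows "fst (split_tree t i) \<le> fst (split_tree t' i) \<and> snd (split_tree t i) \<le> snd (split_tree t' i)"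
proof -
  have cover: "fst (split_tree t i) \<le> fst (split_tree t' i) \<and> snd (split_tree t i) \<le> snd (split_tree t' i)"
    if "tamari_cover t t'" for t t' i
    using that
  proof (induction arbitrary: i rule: tamari_cover.induct)
    case (rotate x y z)
    have "i - nnodes x - 1 \<le> nnodes y \<longleftrightarrow> i \<le> Suc (nnodes x + nnodes y)"
      "i - Suc (nnodes x + nnodes y) - 1 = i - nnodes x - 1 - nnodes y - 1" by auto
    then show ?case
      by (auto split: prod.splits simp: tamari_rotate)
  next
    case (left l l' r)
    then have "Node l r \<le> Node l' r" "nnodes l = nnodes l'" "l \<le> l'"
      by (auto simp: less_eq_ptree_def tamari_cover_nnodes intro: tamari_cover.left)
    with left.IH[of i] show ?case
      by (auto split: prod.splits intro: tamari_le_Node)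
  next
    case (right r r' l)
    then have "r \<le> r'" by (auto simp: less_eq_ptree_def)
    with right.IH[of "i - nnodes l - 1"] show ?case
      by (auto split: prod.splits intro: tamari_le_Node)
  qed
  from assms show ?thesis
    unfolding less_eq_ptree_def[of t t']
    by (induction rule: rtranclp_induct) (auto dest: cover[of _ _ i] intro: order.trans)
qed

text \<open>
  The adjunction between splitting and grafting. \<open>split_tree\<close> is monotone and undoes
  \<open>graft\<close>, which gives one direction; \<open>graft\<close> is monotone and \<open>le_graft_split\<close> is the
  unit, which gives the other.
\<close>

lemma le_graft_iff:
  "t \<le> graft r s \<longleftrightarrow>
     nnodes r \<le> nnodes t \<and> fst (split_tree t (nnodes r)) \<le> r \<and> snd (split_tree t (nnodes r)) \<le> s"
proof
  assume le: "t \<le> graft r s"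
  then have "nnodes t = nnodes r + nnodes s" using le_nnodes[OF le] by simp
  then show "nnodes r \<le> nnodes t \<and> fst (split_tree t (nnodes r)) \<le> r \<and> snd (split_tree t (nnodes r)) \<le> s"
    using split_mono[OF le, of "nnodes r"] by (simp add: split_graft)
next
  assume "nnodes r \<le> nnodes t \<and> fst (split_tree t (nnodes r)) \<le> r \<and> snd (split_tree t (nnodes r)) \<le> s"
  then show "t \<le> graft r s"
    using le_graft_split[of t "nnodes r"] graft_mono by (blast intro: order.trans)
qed

text \<open>
  The ideal of \<open>c\<close> lies in \<open>{1..bl_degree c}\<close>, hence it is contained in the ideal of
  \<open>b\<close> iff it is contained in the ideal of the left part of \<open>b\<close>.
\<close>

lemma le_bl_graft_iff:
  "b \<le> c \<setminus> s \<longleftrightarrow>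
     bl_degree c \<le> bl_degree b \<and> bl_left b (bl_degree c) \<le> c \<and> snd (split_tree (tree_of b) (bl_degree c)) \<le> s"
proof -
  have c: "ideal_of c \<subseteq> {1..bl_degree c}"
    using bileveled_bltree[of c] by (simp add: bileveled_def bl_degree_def)
  show ?thesis
    using c bl_degree_pos[of c]
    by (auto simp: less_eq_bltree_def le_graft_iff bl_left_sel bl_degree_def[symmetric])
      (auto simp: bl_degree_def)
qed

lemma graft_assoc: "graft (graft r s) u = graft r (graft s u)"
  by (induction r) auto

lemma bl_graft_assoc: "c \<setminus> s \<setminus> u = c \<setminus> graft s u"
  by (rule bltree_eqI) (simp_all add: graft_assoc)

lemma bl_graft_Leaf: "c \<setminus> Leaf = c"
  by (rule bltree_eqI) simp_all

lemma bl_degree_graft: "bl_degree (c \<setminus> s) = bl_degree c + nnodes s"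
  by (simp add: bl_degree_def)


section \<open>Coactions on the Moebius basis\<close>

lemma finite_factorizations:
  fixes wt :: "'x \<Rightarrow> nat"
  assumes "\<And>y s. wt (act y s) = wt y + nnodes s" "\<And>n. finite {x. wt x = n}"
  shows "finite {(y, s). act y s = x}"
proof (rule finite_subset)
  show "{(y, s). act y s = x} \<subseteq> (\<Union>n\<le>wt x. {y. wt y = n}) \<times> (\<Union>n\<le>wt x. {s. nnodes s = n})"
    by (auto simp: assms(1))
qed (auto simp: assms(2) finite_trees)

text \<open>
  By \<open>galois\<close>, the pairs \<open>(c, s)\<close> with
  \<open>x \<le> act c s\<close> can be grouped either by the splitting position \<open>d c\<close>, which gives the
  coaction on \<open>bvec x\<close>, or by the element \<open>act c s\<close> above \<open>x\<close>, which gives the sum that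
  \<open>qlinear_mvec_eq\<close> inverts.
\<close>

lemma coact_mvec:
  fixes pre :: "'a::upper_finite_order \<Rightarrow> nat \<Rightarrow> 'a" and post :: "'a \<Rightarrow> nat \<Rightarrow> ptree"
    and f :: "'a qvec \<Rightarrow> ('a \<times> ptree) qvec"
  assumes f: "qlinear f"
    and bvec: "\<And>x. f (bvec x) = (\<Sum>i\<in>I x. bvec (pre x i) \<otimes> bvec (post x i))"
    and fin: "\<And>x. finite (I x)"
    and deg: "\<And>x i c. i \<in> I x \<Longrightarrow> pre x i \<le> c \<Longrightarrow> d c = i"
    and galois: "\<And>x c s. x \<le> act c s \<longleftrightarrow> d c \<in> I x \<and> pre x (d c) \<le> c \<and> post x (d c) \<le> s"
  shows "f (mvec x) = (\<Sum>(c, s) | act c s = x. mvec c \<otimes> mvec s)"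
proof (rule qlinear_mvec_eq[OF f])
  fix x
  \<comment> \<open>The position is recorded in the first component, although it is determined as \<open>d c\<close>.\<close>
  define P where "P = (SIGMA i:I x. {pre x i..} \<times> {post x i..})"
  have finP: "finite P" unfolding P_def by (intro finite_SigmaI) (auto simp: fin finite_atLeast)
  have P: "{(c, s). x \<le> act c s} = snd ` P"
  proof (intro equalityI subsetI)
    fix q assume "q \<in> {(c, s). x \<le> act c s}"
    then have "(d (fst q), q) \<in> P" by (auto simp: P_def galois)
    then show "q \<in> snd ` P" by force
  next
    fix q assume "q \<in> snd ` P"
    then obtain i c s where "q = (c, s)" "i \<in> I x" "pre x i \<le> c" "post x i \<le> s"
      by (auto simp: P_def)
    with deg[of i x c] show "q \<in> {(c, s). x \<le> act c s}" by (simp add: galois)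
  qed
  have inj: "inj_on snd P"
    unfolding P_def by (auto intro!: inj_onI dest: deg)
  have fin': "finite {(c, s). act c s = y}" if "x \<le> y" for y
  proof (rule finite_subset)
    show "{(c, s). act c s = y} \<subseteq> snd ` P" unfolding P[symmetric] using that by auto
  qed (use finP in simp)
  have "f (bvec x) = (\<Sum>i\<in>I x. \<Sum>(c, s)\<in>{pre x i..} \<times> {post x i..}. mvec c \<otimes> mvec s)"
    unfolding bvec
    by (simp add: bvec_eq_sum_mvec[of "pre x i" for i] bvec_eq_sum_mvec[of "post x i" for i]
        tensor_sum_sum del: tensor_bvec)
  also have "\<dots> = (\<Sum>(i, c, s)\<in>P. mvec c \<otimes> mvec s)"
    unfolding P_def by (subst sum.Sigma) (auto simp: fin finite_atLeast)
  also have "\<dots> = (\<Sum>(c, s) | x \<le> act c s. mvec c \<otimes> mvec s)"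
    unfolding P by (subst sum.reindex[OF inj]) (auto simp: case_prod_beta)
  also have "\<dots> = (\<Sum>(y, c, s) \<in> (SIGMA y:{x..}. {(c, s). act c s = y}). mvec c \<otimes> mvec s)"
    by (rule sum.reindex_bij_witness[of _ snd "\<lambda>(c, s). (act c s, c, s)"]) auto
  also have "\<dots> = (\<Sum>y\<in>{x..}. \<Sum>(c, s) | act c s = y. mvec c \<otimes> mvec s)"
    by (subst sum.Sigma) (auto simp: finite_atLeast fin')
  finally show "f (bvec x) = (\<Sum>y\<in>{x..}. \<Sum>(c, s) | act c s = y. mvec c \<otimes> mvec s)" .
qed

lemma qlinear_Delta: "qlinear Delta"
  and qlinear_rho: "qlinear rho"
  unfolding Delta_def rho_def by (rule qlinear_lin_ext)+

lemma Delta_mvec: "Delta (mvec t) = (\<Sum>(r, s) | graft r s = t. mvec r \<otimes> mvec s)"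
proof (rule coact_mvec[where d = nnodes])
  show "Delta (bvec x) = (\<Sum>i\<in>{..nnodes x}. bvec (fst (split_tree x i)) \<otimes> bvec (snd (split_tree x i)))" for x
    by (simp add: Delta_def)
qed (auto simp: le_graft_iff Delta_def qlinear_lin_ext nnodes_split_tree dest!: le_nnodes)

text \<open>
  A bi-leveled tree has degree at least 1, so the condition that the left part is not a leaf excludes
  exactly the position 0.
\<close>

lemma rho_mvec: "rho (mvec b) = (\<Sum>(c, s) | c \<setminus> s = b. mvec c \<otimes> mvec s)"
proof (rule coact_mvec[where d = bl_degree])
  show "rho (bvec x) = (\<Sum>i\<in>{1..bl_degree x}. bvec (bl_left x i) \<otimes> bvec (snd (split_tree (tree_of x) i)))" for x
  proof -
    have "fst (split_tree (tree_of x) i) \<noteq> Leaf \<longleftrightarrow> 1 \<le> i" if "i \<le> bl_degree x" for i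
      using nnodes_split_tree[of i "tree_of x"] that nnodes_0_iff[of "fst (split_tree (tree_of x) i)"]
      by (auto simp: bl_degree_def simp del: nnodes_0_iff)
    then have "{i. i \<le> bl_degree x \<and> fst (split_tree (tree_of x) i) \<noteq> Leaf} = {1..bl_degree x}"
      unfolding set_eq_iff mem_Collect_eq atLeastAtMost_iff by blast
    then show ?thesis by (simp add: rho_def)
  qed
  show "bl_degree c = i" if "i \<in> {1..bl_degree x}" "bl_left x i \<le> c" for x i c
    using that le_nnodes[of "tree_of (bl_left x i)" "tree_of c"]
    by (auto simp: less_eq_bltree_def bl_left_sel bl_degree_def nnodes_split_tree)
qed (use bl_degree_pos in \<open>auto simp: le_bl_graft_iff rho_def qlinear_lin_ext Suc_le_eq\<close>)


section \<open>Comodules with a basis indexed by an action of grafting\<close>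

text \<open>
  Three comodules share one pattern: homogeneous vectors \<open>e\<close> indexed by a graded set on
  which trees act by grafting, with a coaction that sums over all ways to write the index as
  \<open>act y s\<close>. The grading \<open>vdeg\<close> lives on the basis of the vectors \<open>bvec a\<close>. The
  condition \<open>e_spans\<close> links it to \<open>e\<close> and implies that the \<open>e x\<close> span; it has no
  coefficients because \<open>bvec_eq_sum_mvec\<close> has none.
\<close>

locale grafting_basis =
  fixes e :: "'x \<Rightarrow> 'v qvec" and act :: "'x \<Rightarrow> ptree \<Rightarrow> 'x" and wt :: "'x \<Rightarrow> nat"
    and vdeg :: "'v \<Rightarrow> nat" and coact :: "'v qvec \<Rightarrow> ('v \<times> ptree) qvec"
  assumes act_Leaf: "act x Leaf = x"
    and act_act: "act (act x s) u = act x (graft s u)"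
    and wt_act: "wt (act x s) = wt x + nnodes s"
    and finite_decomp: "finite {(y, s). act y s = x}"
    and e_homogeneous: "e x \<in> homogeneous vdeg (wt x)"
    and e_spans: "\<exists>X. bvec a = sum e X \<and> (\<forall>x\<in>X. wt x = vdeg a)"
    and linear_coact: "qlinear coact"
    and coact_e: "coact (e x) = (\<Sum>(y, s) | act y s = x. e y \<otimes> mvec s)"
begin

lemma linear_eqI:
  assumes "qlinear f" "qlinear g" "\<And>x. f (e x) = g (e x)"
  shows "f = g"
proof (rule qlinear_eqI[OF assms(1,2)])
  fix a
  from e_spans[of a] obtain X where "bvec a = sum e X" by blast
  then show "f (bvec a) = g (bvec a)" by (simp add: assms qlinear_sum)
qed

lemma graded_eI:
  assumes "qlinear f" "\<And>x. f (e x) \<in> homogeneous d (wt x)"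
  shows "graded_map vdeg d f"
proof (rule graded_mapI[OF assms(1)])
  fix a
  from e_spans[of a] obtain X where "bvec a = sum e X" "\<forall>x\<in>X. wt x = vdeg a" by blast
  then show "f (bvec a) \<in> homogeneous d (vdeg a)"
    using assms by (auto simp: qlinear_sum intro!: homogeneous_sum) (metis assms(2))
qed

text \<open>
  Both sides sum over the ways to write the index as a product of an element and two trees;
  associativity of the action says that the two bracketings agree.
\<close>

lemma coassociative: "tensor_map coact id (coact v) = reassoc (tensor_map id Delta (coact v))"
proof -
  let ?f = "\<lambda>(y, r, u). (e y \<otimes> mvec r) \<otimes> mvec u"
  have fin: "finite {(r, u). graft r u = s}" for s
    by (rule finite_factorizations[where wt = nnodes]) (auto simp: finite_trees)
  have "(\<lambda>v. tensor_map coact id (coact v)) = (\<lambda>v. reassoc (tensor_map id Delta (coact v)))"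
  proof (rule linear_eqI)
    fix x
    have "tensor_map coact id (coact (e x))
        = (\<Sum>(z, u) | act z u = x. \<Sum>(y, r) | act y r = z. (e y \<otimes> mvec r) \<otimes> mvec u)"
      by (simp add: coact_e qlinear_sum[OF qlinear_tensor_map] case_prod_beta
          tensor_map_tensor linear_coact qlinear_id tensor_sum_left)
    also have "\<dots> = (\<Sum>((z, u), y, r)\<in>(SIGMA (z, u):{(z, u). act z u = x}. {(y, r). act y r = z}).
        (e y \<otimes> mvec r) \<otimes> mvec u)"
      by (subst sum.Sigma[symmetric]) (auto simp: finite_decomp case_prod_beta)
    also have "\<dots> = sum ?f {(y, r, u). act y (graft r u) = x}"
      by (rule sum.reindex_bij_witness[of _ "\<lambda>(y, r, u). ((act y r, u), y, r)" "\<lambda>((z, u), y, r). (y, r, u)"])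
         (auto simp: act_act)
    also have "\<dots> = (\<Sum>((y, s), r, u)\<in>(SIGMA (y, s):{(y, s). act y s = x}. {(r, u). graft r u = s}).
        (e y \<otimes> mvec r) \<otimes> mvec u)"
      by (rule sum.reindex_bij_witness[of _ "\<lambda>((y, s), r, u). (y, r, u)" "\<lambda>(y, r, u). ((y, graft r u), r, u)"])
         auto
    also have "\<dots> = (\<Sum>(y, s) | act y s = x. \<Sum>(r, u) | graft r u = s. (e y \<otimes> mvec r) \<otimes> mvec u)"
      by (subst sum.Sigma[symmetric]) (auto simp: finite_decomp fin case_prod_beta)
    also have "\<dots> = reassoc (tensor_map id Delta (coact (e x)))"
      by (simp add: coact_e qlinear_sum[OF qlinear_tensor_map] qlinear_sum[OF qlinear_reassoc]
          case_prod_beta tensor_map_tensor qlinear_Delta qlinear_id Delta_mvec tensor_sum_right reassoc_tensor)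
    finally show "tensor_map coact id (coact (e x)) = reassoc (tensor_map id Delta (coact (e x)))" .
  qed (auto intro!: qlinear_intros linear_coact)
  then show ?thesis by metis
qed

text \<open>
  Only the factorization \<open>x = act x Leaf\<close> survives the counit.
\<close>

lemma counital: "contract_right epsilon (coact v) = v"
proof -
  have "(\<lambda>v. contract_right epsilon (coact v)) = (\<lambda>v. v)"
  proof (rule linear_eqI)
    fix x
    have "contract_right epsilon (coact (e x)) = (\<Sum>(y, s) | act y s = x. qscale (epsilon (mvec s)) (e y))"
      by (simp add: coact_e qlinear_sum[OF qlinear_contract_right] case_prod_beta contract_right_epsilon)
    also have "\<dots> = (\<Sum>p | act (fst p) (snd p) = x. if p = (x, Leaf) then e x else 0)"
      by (rule sum.cong) (auto simp: epsilon_mvec act_Leaf split: if_splits)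
    also have "\<dots> = e x"
      using finite_decomp[of x] by (subst sum.delta) (auto simp: act_Leaf case_prod_unfold)
    finally show "contract_right epsilon (coact (e x)) = e x" .
  qed (auto intro!: qlinear_intros linear_coact qlinear_id)
  then show ?thesis by metis
qed

lemma graded: "graded_map vdeg (deg_pair vdeg nnodes) coact"
proof (rule graded_eI[OF linear_coact])
  fix x
  have "e y \<otimes> mvec s \<in> homogeneous (deg_pair vdeg nnodes) (wt x)" if "act y s = x" for y s
    unfolding that[symmetric] wt_act
    by (intro homogeneous_tensor e_homogeneous homogeneous_mvec) (rule le_nnodes)
  then show "coact (e x) \<in> homogeneous (deg_pair vdeg nnodes) (wt x)"
    unfolding coact_e by (auto intro!: homogeneous_sum)
qed

end

text \<open>
  Trees acted on by grafting give the coalgebra as a comodule over itself, and with it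
  coassociativity, the right counit law and the homogeneity of \<open>Delta\<close>.
\<close>

interpretation tree: grafting_basis mvec graft nnodes nnodes Delta
proof (rule grafting_basis.intro)
  show "mvec t \<in> homogeneous nnodes (nnodes t)" for t
    by (intro homogeneous_mvec) (rule le_nnodes)
  show "\<exists>X. bvec t = sum mvec X \<and> (\<forall>x\<in>X. nnodes x = nnodes t)" for t
    by (intro exI[of _ "{t..}"]) (auto simp: bvec_eq_sum_mvec dest: le_nnodes)
  show "finite {(y, s). graft y s = x}" for x
    by (rule finite_factorizations[where wt = nnodes]) (auto simp: finite_trees)
qed (auto simp: graft_assoc Delta_mvec qlinear_Delta)

lemma counit_left_Delta: "contract_left epsilon (Delta x) = x"
proof -
  have "(\<lambda>v. contract_left epsilon (Delta v)) = (\<lambda>v. v)"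
  proof (rule tree.linear_eqI)
    fix t
    have "contract_left epsilon (Delta (mvec t)) = (\<Sum>(r, s) | graft r s = t. qscale (epsilon (mvec r)) (mvec s))"
      by (simp add: Delta_mvec qlinear_sum[OF qlinear_contract_left] case_prod_beta contract_left_epsilon)
    also have "\<dots> = (\<Sum>p | graft (fst p) (snd p) = t. if p = (Leaf, t) then mvec t else 0)"
      by (rule sum.cong) (auto simp: epsilon_mvec split: if_splits)
    also have "\<dots> = mvec t"
      using tree.finite_decomp[of t] by (subst sum.delta) (auto simp: case_prod_unfold)
    finally show "contract_left epsilon (Delta (mvec t)) = mvec t" .
  qed (auto intro!: qlinear_intros tree.linear_coact qlinear_id)
  then show ?thesis by metis
qed

lemma coalgebra: "graded_coalgebra nnodes Delta epsilon"
proof (rule graded_coalgebra.intro)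
  show "epsilon x = 0" if "x \<in> homogeneous nnodes n" "n \<noteq> 0" for x n
    using that by (force simp: epsilon_def homogeneous_def in_keys_iff)
qed (rule tree.linear_coact linear_epsilon tree.coassociative counit_left_Delta tree.counital tree.graded)+

lemma (in grafting_basis) comodule: "graded_right_comodule nnodes Delta epsilon vdeg coact"
  by (intro graded_right_comodule.intro graded_right_comodule_axioms.intro
      coalgebra linear_coact coassociative counital graded)

abbreviation cofree_vec :: "indec \<times> ptree \<Rightarrow> (indec \<times> ptree) qvec" where
  "cofree_vec \<equiv> \<lambda>(b, s). bvec b \<otimes> mvec s"

abbreviation cofree_act :: "indec \<times> ptree \<Rightarrow> ptree \<Rightarrow> indec \<times> ptree" where
  "cofree_act \<equiv> \<lambda>(b, s) u. (b, graft s u)"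

interpretation cofree: grafting_basis cofree_vec cofree_act
  "deg_pair indec_degree nnodes" "deg_pair indec_degree nnodes" cofree_coact
proof (rule grafting_basis.intro)
  fix x a :: "indec \<times> ptree" and u v
  obtain b s where x: "x = (b, s)" by (cases x)
  have decomp: "{(y, u). cofree_act y u = x}
      = (\<lambda>(r, u). ((b, r), u)) ` {(r, u). graft r u = s}"
    by (auto simp: x)
  show "cofree_act x Leaf = x"
    by (simp add: x)
  show "cofree_act (cofree_act x u) v
      = cofree_act x (graft u v)"
    by (simp add: x graft_assoc)
  show "deg_pair indec_degree nnodes (cofree_act x u)
      = deg_pair indec_degree nnodes x + nnodes u"
    by (simp add: x deg_pair_def)
  show "finite {(y, u). cofree_act y u = x}"
    unfolding decomp by (intro finite_imageI tree.finite_decomp)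
  have "bvec b \<otimes> mvec s \<in> homogeneous (deg_pair indec_degree nnodes) (indec_degree b + nnodes s)"
    by (intro homogeneous_tensor homogeneous_bvec homogeneous_mvec) (rule le_nnodes)
  then show "cofree_vec x
      \<in> homogeneous (deg_pair indec_degree nnodes) (deg_pair indec_degree nnodes x)"
    by (simp add: x deg_pair_def)
  obtain c t where a: "a = (c, t)" by (cases a)
  have "bvec a = (\<Sum>s\<in>{t..}. bvec c \<otimes> mvec s)"
    by (simp add: a tensor_sum_right[symmetric] bvec_eq_sum_mvec[symmetric])
  also have "\<dots> = sum cofree_vec (Pair c ` {t..})"
    by (subst sum.reindex) (auto simp: inj_on_def)
  finally show "\<exists>X. bvec a = sum cofree_vec X
      \<and> (\<forall>x\<in>X. deg_pair indec_degree nnodes x = deg_pair indec_degree nnodes a)"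
    by (intro exI[of _ "Pair c ` {t..}"]) (auto simp: a deg_pair_def dest: le_nnodes)
  show "cofree_coact (cofree_vec x)
      = (\<Sum>(y, u) | cofree_act y u = x.
          cofree_vec y \<otimes> mvec u)"
    unfolding decomp unfolding x
    by (subst sum.reindex)
       (auto simp: inj_on_def cofree_coact_tensor Delta_mvec tensor_sum_right
          qlinear_sum[OF qlinear_reassoc] case_prod_beta reassoc_tensor)
  show "qlinear cofree_coact"
    unfolding cofree_coact_def by (intro qlinear_intros qlinear_tensor_map)
qed

interpretation MSym: grafting_basis mvec bl_graft bl_degree bl_degree rho
proof (rule grafting_basis.intro)
  have le: "bl_degree b = bl_degree c" if "b \<le> c" for b c
    using that by (simp add: less_eq_bltree_def bl_degree_def le_nnodes)
  show "mvec b \<in> homogeneous bl_degree (bl_degree b)" for b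
    by (intro homogeneous_mvec) (rule le)
  show "\<exists>X. bvec b = sum mvec X \<and> (\<forall>x\<in>X. bl_degree x = bl_degree b)" for b
    by (intro exI[of _ "{b..}"]) (auto simp: bvec_eq_sum_mvec dest: le)
  show "finite {(c, s). c \<setminus> s = b}" for b
    by (rule finite_factorizations[where wt = bl_degree]) (auto simp: finite_bltrees bl_degree_graft)
qed (auto simp: bl_graft_assoc bl_graft_Leaf bl_degree_graft rho_mvec qlinear_rho)


section \<open>Unique factorization of bi-leveled trees\<close>

text \<open>
  The right branch of \<open>graft t s\<close> begins with that of \<open>t\<close>, so two left factors of the same
  tree are comparable.
\<close>

lemma graft_eq_graft:
  "graft t s = graft t' s' \<Longrightarrow> nnodes t \<le> nnodes t' \<Longrightarrow> \<exists>r. t' = graft t r \<and> s = graft r s'"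
proof (induction t arbitrary: t')
  case (Node a c)
  then show ?case by (cases t') auto
qed auto

lemma bl_graft_eq_bl_graft:
  assumes eq: "b \<setminus> s = c \<setminus> u" and le: "bl_degree b \<le> bl_degree c"
  shows "\<exists>r. c = b \<setminus> r \<and> s = graft r u"
proof -
  have "graft (tree_of b) s = graft (tree_of c) u" and id: "ideal_of b = ideal_of c"
    using arg_cong[OF eq, of tree_of] arg_cong[OF eq, of ideal_of] by simp_all
  then obtain r where "tree_of c = graft (tree_of b) r" "s = graft r u"
    using graft_eq_graft le unfolding bl_degree_def by blast
  then show ?thesis using id by (auto intro!: bltree_eqI)
qed

text \<open>
  If \<open>c\<close> were the strictly smaller of the two left factors, then it would be a proper left factor of the
  indecomposable \<open>b\<close>.
\<close>

lemma indecomposable_prefix: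
  assumes "indecomposable b" "b \<setminus> s = c \<setminus> u"
  shows "\<exists>r. c = b \<setminus> r \<and> s = graft r u"
proof (cases "bl_degree b \<le> bl_degree c")
  case False
  then obtain r where "b = c \<setminus> r"
    using bl_graft_eq_bl_graft[of c u b s] assms(2) by auto
  then have "c = b" using assms(1) by (simp add: indecomposable_def)
  with False show ?thesis by simp
qed (use assms bl_graft_eq_bl_graft in blast)

lemma factorization_unique:
  assumes "indecomposable b" "indecomposable c" "b \<setminus> s = c \<setminus> u"
  shows "b = c \<and> s = u"
proof -
  obtain r where "c = b \<setminus> r" "s = graft r u"
    using indecomposable_prefix[OF assms(1,3)] by blast
  then show ?thesis
    using assms(2)[unfolded indecomposable_def] by (metis graft.simps(1))
qed

lemma factorization_exists: "\<exists>b s. indecomposable b \<and> d = b \<setminus> s"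
proof (induction "bl_degree d" arbitrary: d rule: less_induct)
  case less
  show ?case
  proof (cases "indecomposable d")
    case True
    then show ?thesis using bl_graft_Leaf[of d] by metis
  next
    case False
    then obtain c s where d: "d = c \<setminus> s" and "\<not> (c = d \<and> s = Leaf)"
      unfolding indecomposable_def by blast
    then have "s \<noteq> Leaf" using bl_graft_Leaf by auto
    then have "bl_degree c < bl_degree d" by (simp add: d bl_degree_graft neq0_conv[symmetric])
    from less[OF this] obtain b r where "indecomposable b" "c = b \<setminus> r" by blast
    then show ?thesis by (auto simp: d bl_graft_assoc)
  qed
qed

lemma bij_factorization: "bij (\<lambda>(b, s). Rep_indec b \<setminus> s)"
proof (rule bijI)
  show "inj (\<lambda>(b, s). Rep_indec b \<setminus> s)"
  proof (rule injI)
    fix p q :: "indec \<times> ptree"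
    have "indecomposable (Rep_indec b)" for b using Rep_indec by auto
    moreover assume "(\<lambda>(b, s). Rep_indec b \<setminus> s) p = (\<lambda>(b, s). Rep_indec b \<setminus> s) q"
    ultimately show "p = q"
      using factorization_unique[of "Rep_indec (fst p)" "Rep_indec (fst q)" "snd p" "snd q"]
      by (auto simp: case_prod_unfold Rep_indec_inject intro: prod_eqI)
  qed
  show "surj (\<lambda>(b, s). Rep_indec b \<setminus> s)"
  proof (unfold surj_def, rule allI)
    fix d
    obtain b s where "indecomposable b" "d = b \<setminus> s" using factorization_exists by blast
    then show "\<exists>p. d = (case p of (b, s) \<Rightarrow> Rep_indec b \<setminus> s)"
      by (intro exI[of _ "(Abs_indec b, s)"]) (simp add: Abs_indec_inverse)
  qed
qed

lemma bl_series_factorization: "bl_series = indec_series * tree_series"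
proof (rule fps_ext)
  fix n
  let ?I = "\<lambda>i. {b. indecomposable b \<and> bl_degree b = i}" and ?T = "\<lambda>i. {t. nnodes t = i}"
  let ?X = "SIGMA i:{0..n}. ?I i \<times> ?T (n - i)"
  have "bij_betw (\<lambda>(i, b, s). b \<setminus> s) ?X {d. bl_degree d = n}"
    unfolding bij_betw_def
  proof
    show "inj_on (\<lambda>(i, b, s). b \<setminus> s) ?X"
    proof (rule inj_onI)
      fix p q assume "p \<in> ?X" "q \<in> ?X" "(\<lambda>(i, b, s). b \<setminus> s) p = (\<lambda>(i, b, s). b \<setminus> s) q"
      then show "p = q"
        using factorization_unique[of "fst (snd p)" "fst (snd q)" "snd (snd p)" "snd (snd q)"] by auto
    qed
    show "(\<lambda>(i, b, s). b \<setminus> s) ` ?X = {d. bl_degree d = n}"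
    proof (intro equalityI subsetI)
      fix d assume d: "d \<in> {d. bl_degree d = n}"
      obtain b s where "indecomposable b" "d = b \<setminus> s" using factorization_exists by blast
      with d show "d \<in> (\<lambda>(i, b, s). b \<setminus> s) ` ?X"
        by (intro image_eqI[of _ _ "(bl_degree b, b, s)"]) (auto simp: bl_degree_graft)
    qed (auto simp: bl_degree_graft)
  qed
  then have "card {d. bl_degree d = n} = card ?X" by (simp add: bij_betw_same_card)
  also have "\<dots> = (\<Sum>i\<in>{0..n}. card (?I i) * card (?T (n - i)))"
    by (subst card_SigmaI)
       (auto simp: card_cartesian_product finite_trees intro!: finite_cartesian_product
          finite_subset[OF _ finite_bltrees])
  finally show "fps_nth bl_series n = fps_nth (indec_series * tree_series) n"
    by (simp add: bl_series_def indec_series_def tree_series_def fps_mult_nth)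
qed

lemma bl_series_quotient: "bl_series / tree_series = indec_series"
proof -
  have "fps_nth tree_series 0 = 1" by (simp add: tree_series_def)
  then have "tree_series \<noteq> 0" by auto
  then show ?thesis by (simp add: bl_series_factorization)
qed


section \<open>The isomorphism\<close>

text \<open>
  The map is prescribed on \<open>bvec b \<otimes> mvec s\<close> but has to be defined on
  \<open>bvec b \<otimes> bvec s\<close>; the values there are the up-set sums that Moebius inversion undoes.
\<close>

lemma factor_map_exists:
  "\<exists>\<Phi> :: (indec \<times> ptree) qvec \<Rightarrow> bltree qvec.
     qlinear \<Phi> \<and> (\<forall>b s. \<Phi> (bvec b \<otimes> mvec s) = mvec (Rep_indec b \<setminus> s))"
proof (intro exI conjI allI)
  let ?\<Phi> = "lin_ext (\<lambda>(b, s). \<Sum>s'\<in>{s..}. mvec (Rep_indec b \<setminus> s'))"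
  show "qlinear ?\<Phi>" by (rule qlinear_lin_ext)
  fix b s
  show "?\<Phi> (bvec b \<otimes> mvec s) = mvec (Rep_indec b \<setminus> s)"
  proof (rule qlinear_mvec_eq[where f = "\<lambda>y. ?\<Phi> (bvec b \<otimes> y)"])
    show "qlinear (\<lambda>y. ?\<Phi> (bvec b \<otimes> y))"
      by (rule qlinear_comp[OF qlinear_lin_ext qlinear_tensor_right])
  qed simp
qed

lemma factor_map_unique:
  assumes "qlinear \<Phi>" "\<And>b s. \<Phi> (bvec b \<otimes> mvec s) = mvec (Rep_indec b \<setminus> s)"
    and "qlinear \<Psi>" "\<And>b s. \<Psi> (bvec b \<otimes> mvec s) = mvec (Rep_indec b \<setminus> s)"
  shows "\<Phi> = \<Psi>"
  by (rule cofree.linear_eqI[OF assms(1,3)]) (simp add: assms(2,4) split: prod.split)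

text \<open>
  The inverse sends \<open>M\<close> of \<open>d\<close> to the vector indexed by the factorization of \<open>d\<close>.
  Colinearity is the bijection between factorizations of \<open>s\<close> and of
  \<open>Rep_indec b \<setminus> s\<close>.
\<close>

lemma factor_map_iso:
  assumes lin: "qlinear \<Phi>" and \<Phi>: "\<And>b s. \<Phi> (bvec b \<otimes> mvec s) = mvec (Rep_indec b \<setminus> s)"
  shows "graded_right_comodule_iso nnodes Delta epsilon
    (deg_pair indec_degree nnodes) cofree_coact bl_degree rho \<Phi>"
proof -
  let ?p = "\<lambda>(b, s). Rep_indec b \<setminus> s" and ?e = cofree_vec
  have \<Phi>e: "\<Phi> (?e x) = mvec (?p x)" for x by (cases x) (simp add: \<Phi>)
  show ?thesis
  proof (intro graded_right_comodule_iso.intro graded_right_comodule_iso_axioms.intro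
      cofree.comodule MSym.comodule)
    show "qlinear \<Phi>" by (rule lin)
    define \<Psi> where "\<Psi> = lin_ext (\<lambda>d. \<Sum>d'\<in>{d..}. ?e (inv ?p d'))"
    have \<Psi>: "qlinear \<Psi>" unfolding \<Psi>_def by (rule qlinear_lin_ext)
    have \<Psi>_mvec: "\<Psi> (mvec d) = ?e (inv ?p d)" for d
      by (rule qlinear_mvec_eq[OF \<Psi>]) (simp add: \<Psi>_def)
    have "(\<lambda>v. \<Psi> (\<Phi> v)) = (\<lambda>v. v)"
    proof (rule cofree.linear_eqI)
      show "\<Psi> (\<Phi> (?e x)) = ?e x" for x
        unfolding \<Phi>e \<Psi>_mvec using bij_factorization by (simp add: bij_is_inj)
    qed (rule qlinear_comp[OF \<Psi> lin] qlinear_id)+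
    moreover have "(\<lambda>w. \<Phi> (\<Psi> w)) = (\<lambda>w. w)"
    proof (rule MSym.linear_eqI)
      show "\<Phi> (\<Psi> (mvec d)) = mvec d" for d
        unfolding \<Psi>_mvec \<Phi>e using bij_factorization by (simp add: bij_is_surj surj_f_inv_f)
    qed (rule qlinear_comp[OF lin \<Psi>] qlinear_id)+
    ultimately show "bij \<Phi>" by (intro o_bij[of \<Psi>]) (auto simp: fun_eq_iff)
    show "graded_map (deg_pair indec_degree nnodes) bl_degree \<Phi>"
    proof (rule cofree.graded_eI[OF lin])
      fix x
      have "bl_degree (?p x) = deg_pair indec_degree nnodes x"
        by (cases x) (simp add: bl_degree_graft deg_pair_def indec_degree_def)
      then show "\<Phi> (?e x) \<in> homogeneous bl_degree (deg_pair indec_degree nnodes x)"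
        unfolding \<Phi>e by (metis MSym.e_homogeneous)
    qed
    have "(\<lambda>v. rho (\<Phi> v)) = (\<lambda>v. tensor_map \<Phi> id (cofree_coact v))"
    proof (rule cofree.linear_eqI)
      fix x :: "indec \<times> ptree"
      obtain b s where x: "x = (b, s)" by (cases x)
      have ind: "indecomposable (Rep_indec b)" using Rep_indec by auto
      have inj: "Rep_indec b \<setminus> r = Rep_indec b \<setminus> r' \<Longrightarrow> r = r'" for r r'
        using bij_is_inj[OF bij_factorization] by (auto dest: injD[of _ "(b, r)" "(b, r')"])
      have decomp: "{(c, u). c \<setminus> u = Rep_indec b \<setminus> s}
          = (\<lambda>(r, u). (Rep_indec b \<setminus> r, u)) ` {(r, u). graft r u = s}"
      proof (intro equalityI subsetI)
        fix p assume "p \<in> {(c, u). c \<setminus> u = Rep_indec b \<setminus> s}"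
        then obtain c u where "p = (c, u)" "Rep_indec b \<setminus> s = c \<setminus> u" by auto
        then show "p \<in> (\<lambda>(r, u). (Rep_indec b \<setminus> r, u)) ` {(r, u). graft r u = s}"
          using indecomposable_prefix[OF ind] by force
      qed (auto simp: bl_graft_assoc)
      have "rho (\<Phi> (?e x)) = (\<Sum>(c, u) | c \<setminus> u = Rep_indec b \<setminus> s. mvec c \<otimes> mvec u)"
        by (simp add: x \<Phi> rho_mvec)
      also have "\<dots> = (\<Sum>(r, u) | graft r u = s. mvec (Rep_indec b \<setminus> r) \<otimes> mvec u)"
        unfolding decomp
        by (subst sum.reindex) (auto simp: inj_on_def case_prod_beta dest: inj)
      also have "\<dots> = tensor_map \<Phi> id (cofree_coact (?e x))"
        by (simp add: x cofree_coact_tensor Delta_mvec tensor_sum_right qlinear_sum[OF qlinear_reassoc]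
            case_prod_beta reassoc_tensor qlinear_sum[OF qlinear_tensor_map] tensor_map_tensor
            lin qlinear_id \<Phi>)
      finally show "rho (\<Phi> (?e x)) = tensor_map \<Phi> id (cofree_coact (?e x))" .
    qed (rule qlinear_comp[OF MSym.linear_coact lin] qlinear_comp[OF qlinear_tensor_map cofree.linear_coact])+
    then show "rho (\<Phi> v) = tensor_map \<Phi> id (cofree_coact v)" for v by metis
  qed
qed

theorem corollary4p3:
  shows "(\<exists>!\<Phi> :: (indec \<times> ptree) qvec \<Rightarrow> bltree qvec.
            qlinear \<Phi> \<and> (\<forall>b s. \<Phi> (bvec b \<otimes> mvec s) = mvec (Rep_indec b \<setminus> s)))
       \<and> (\<forall>\<Phi> :: (indec \<times> ptree) qvec \<Rightarrow> bltree qvec.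
            qlinear \<Phi> \<and> (\<forall>b s. \<Phi> (bvec b \<otimes> mvec s) = mvec (Rep_indec b \<setminus> s))
            \<longrightarrow> graded_right_comodule_iso nnodes Delta epsilon
                  (deg_pair indec_degree nnodes) cofree_coact bl_degree rho \<Phi>)
       \<and> bl_series / tree_series = indec_series"
proof (intro conjI ex_ex1I allI impI)
  show "\<Phi> = \<Psi>"
    if "qlinear \<Phi> \<and> (\<forall>b s. \<Phi> (bvec b \<otimes> mvec s) = mvec (Rep_indec b \<setminus> s))"
      and "qlinear \<Psi> \<and> (\<forall>b s. \<Psi> (bvec b \<otimes> mvec s) = mvec (Rep_indec b \<setminus> s))"
    for \<Phi> \<Psi> :: "(indec \<times> ptree) qvec \<Rightarrow> bltree qvec"
    by (rule factor_map_unique) (use that in simp_all)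
  show "graded_right_comodule_iso nnodes Delta epsilon
      (deg_pair indec_degree nnodes) cofree_coact bl_degree rho \<Phi>"
    if "qlinear \<Phi> \<and> (\<forall>b s. \<Phi> (bvec b \<otimes> mvec s) = mvec (Rep_indec b \<setminus> s))" for \<Phi>
    by (rule factor_map_iso) (use that in simp_all)
qed (rule factor_map_exists bl_series_quotient)+

end
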